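(* Let $Y_i=\sum_{s}\ell_{is}\partial_s$ ($i\in\{1,\ldots,n\}$, $\ell\in\mathfrak{gl}(n,\mathbb{R}^{n*})$) be $n$ mutually commuting linear vector fields in $\mathbb{R}^n$ with $D=\det\ell\neq0$, and let $\Lambda=\sum_{i<j}\alpha^{ij}\,Y_i\wedge Y_j$ with $\alpha^{ij}\in\mathbb{R}$ (an SRMI Poisson tensor). Then the Lichnerowicz-Poisson cohomology groups of $\Lambda$ over the space $\mathcal{R}$ of cochains with coefficients in the formal power series are given by $$LH^{pr}(\mathcal{R},\Lambda)\simeq LH^{pr}(\mathcal{P},\Lambda)/\ker^{pr}\phi_\sharp\;\oplus\;LH^{p-1,r}(\mathcal{P},\mathcal{R},\Lambda)/\ker^{p-1,r}\phi_\sharp ,$$ for all $p\in\{0,\ldots,n\}$ and $r\in\mathbb{N}$.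
   Context: Real formal cochains: $\mathcal{R}=\bigoplus_{p=0}^n\mathbb{R}[[x_1,\ldots,x_n]]\otimes\bigwedge^p\langle\partial_1,\ldots,\partial_n\rangle$. Potential formal cochains: $\mathcal{P}=D^{-1}\bigoplus_{p=0}^n\mathbb{R}[[x_1,\ldots,x_n]]\otimes\bigwedge^p\langle Y_1,\ldots,Y_n\rangle$, with homogeneous components $\mathcal{P}^{pr}=D^{-1}\mathcal{S}^r\mathbb{R}^{n*}\otimes\bigwedge^p\langle Y_1,\ldots,Y_n\rangle$, where $\mathcal{S}^r\mathbb{R}^{n*}$ is the space of homogeneous polynomials of degree $r$. Expressing the $\partial_j$ through the $Y_k$ with coefficients in $D^{-1}\mathbb{R}[x]$ gives a canonical inclusion $\mathcal{R}\subset\mathcal{P}$, and $\mathcal{R}^{pr}=\mathcal{R}\cap\mathcal{P}^{pr}$. The operator $\partial_\Lambda=[\Lambda,\cdot]_{\mathrm{SN}}$ (Schouten-Nijenhuis bracket) is a differential on $\mathcal{P}$ of bidegree $(1,0)$ that preserves $\mathcal{R}$. $LH^{pr}(\mathcal{R},\Lambda)$, $LH^{pr}(\mathcal{P},\Lambda)$ and $LH^{pr}(\mathcal{P},\mathcal{R},\Lambda)$ denote the bidegree $(p,r)$ cohomology of $(\mathcal{R},\partial_\Lambda)$, of $(\mathcal{P},\partial_\Lambda)$, and of the quotient $(\mathcal{P}/\mathcal{R},\overline{\partial}_\Lambda)$ (relative cohomology), respectively; they vanish for $p<0$. $\phi_\sharp:LH^{pr}(\mathcal{P},\mathcal{R},\Lambda)\to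 LH^{p+1,r}(\mathcal{R},\Lambda)$ is the connecting homomorphism of the long exact sequence induced by $0\to\mathcal{R}\to\mathcal{P}\to\mathcal{P}/\mathcal{R}\to0$ (induced by $\partial_\Lambda$ applied to representatives), and $\ker^{pr}\phi_\sharp\subset LH^{pr}(\mathcal{P},\mathcal{R},\Lambda)$ is its kernel. In the quotient $LH^{pr}(\mathcal{P},\Lambda)/\ker^{pr}\phi_\sharp$, the space $\ker^{pr}\phi_\sharp$, which by exactness equals the image of the natural map $LH^{pr}(\mathcal{P},\Lambda)\to LH^{pr}(\mathcal{P},\mathcal{R},\Lambda)$, is regarded as a subspace of $LH^{pr}(\mathcal{P},\Lambda)$ via a linear section of that map over its image. The isomorphism is one of real vector spaces. *)

theory Defs
  imports
    "HOL-Analysis.Determinants"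
    "HOL-Library.Poly_Mapping"
    "HOL-Computational_Algebra.Polynomial_Factorial"
    "HOL-Algebra.Module"
    "HOL-Algebra.AbelCoset"
begin

section \<open>Formal power series in several variables\<close>

typedef 'n mfps = "UNIV :: (('n \<Rightarrow>\<^sub>0 nat) \<Rightarrow> real) set"
  morphisms mcoeff Abs_mfps ..

text \<open>
  \<^typ>\<open>'n mfps\<close> is the ring of formal power series with real coefficients in the variables
  \<open>x\<^sub>s\<close> (\<open>s :: 'n\<close>), so that \<open>n = CARD('n)\<close>. Exponents are of type \<^typ>\<open>'n \<Rightarrow>\<^sub>0 nat\<close>.
\<close>

setup_lifting type_definition_mfps

lemma mfps_eqI: "(\<And>m. mcoeff f m = mcoeff g m) \<Longrightarrow> f = g"
  by transfer auto

lemma finite_antidiag: "finite {(a, b). a + b = (m :: 'n::finite \<Rightarrow>\<^sub>0 nat)}"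
proof -
  let ?A = "{a :: 'n \<Rightarrow>\<^sub>0 nat. \<forall>i. Poly_Mapping.lookup a i \<le> Poly_Mapping.lookup m i}"
  have "Poly_Mapping.lookup ` ?A \<subseteq> PiE UNIV (\<lambda>i. {..Poly_Mapping.lookup m i})"
    by (auto simp: PiE_def)
  hence "finite (Poly_Mapping.lookup ` ?A)"
    by (rule finite_subset) (auto intro: finite_PiE)
  hence "finite ?A"
    by (rule finite_imageD) (simp add: inj_on_def Poly_Mapping.lookup_inject)
  hence "finite (?A \<times> ?A)" by simp
  moreover have "{(a, b). a + b = m} \<subseteq> ?A \<times> ?A"
    by (auto simp: lookup_add)
  ultimately show ?thesis by (rule finite_subset[rotated])
qed

instantiation mfps :: (finite) comm_ring_1
begin

lift_definition zero_mfps :: "'a mfps" is "\<lambda>_. 0" .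

lift_definition one_mfps :: "'a mfps" is "\<lambda>m. if m = 0 then 1 else 0" .

lift_definition plus_mfps :: "'a mfps \<Rightarrow> 'a mfps \<Rightarrow> 'a mfps" is "\<lambda>f g m. f m + g m" .

lift_definition minus_mfps :: "'a mfps \<Rightarrow> 'a mfps \<Rightarrow> 'a mfps" is "\<lambda>f g m. f m - g m" .

lift_definition uminus_mfps :: "'a mfps \<Rightarrow> 'a mfps" is "\<lambda>f m. - f m" .

lift_definition times_mfps :: "'a mfps \<Rightarrow> 'a mfps \<Rightarrow> 'a mfps"
  is "\<lambda>f g m. \<Sum>(a, b) \<in> {(a, b). a + b = m}. f a * g b" .

instance
proof
  fix f g h :: "'a mfps"
  show "f * g * h = f * (g * h)"
  proof (rule mfps_eqI)
    fix m
    have "mcoeff (f * g * h) m =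
      (\<Sum>(a, b) \<in> {(a, b). a + b = m}. \<Sum>(c, d) \<in> {(c, d). c + d = a}.
         mcoeff f c * mcoeff g d * mcoeff h b)"
      by (simp add: times_mfps.rep_eq sum_distrib_right case_prod_unfold)
    also have "\<dots> = (\<Sum>(p, q) \<in> Sigma {(a, b). a + b = m} (\<lambda>p. {(c, d). c + d = fst p}).
         mcoeff f (fst q) * mcoeff g (snd q) * mcoeff h (snd p))"
      by (subst sum.Sigma[symmetric]) (auto simp: finite_antidiag[unfolded case_prod_unfold] case_prod_unfold)
    also have "\<dots> = (\<Sum>(p, q) \<in> Sigma {(a, b). a + b = m} (\<lambda>p. {(c, d). c + d = snd p}).
         mcoeff f (fst p) * mcoeff g (fst q) * mcoeff h (snd q))"
      by (rule sum.reindex_bij_witness[where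
            i = "\<lambda>(p, q). ((fst p + fst q, snd q), (fst p, fst q))" and
            j = "\<lambda>(p, q). ((fst q, snd q + snd p), (snd q, snd p))"])
         (auto simp: add.assoc)
    also have "\<dots> = (\<Sum>(a, b) \<in> {(a, b). a + b = m}. \<Sum>(c, d) \<in> {(c, d). c + d = b}.
         mcoeff f a * mcoeff g c * mcoeff h d)"
      by (subst sum.Sigma[symmetric]) (auto simp: finite_antidiag[unfolded case_prod_unfold] case_prod_unfold)
    also have "\<dots> = mcoeff (f * (g * h)) m"
      by (simp add: times_mfps.rep_eq sum_distrib_left case_prod_unfold mult.assoc)
    finally show "mcoeff (f * g * h) m = mcoeff (f * (g * h)) m" .
  qed
  show "f * g = g * f"
    by (rule mfps_eqI, simp add: times_mfps.rep_eq,
        rule sum.reindex_bij_witness[where i = prod.swap and j = prod.swap])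
       (auto simp: add.commute)
  show "1 * f = f"
  proof (rule mfps_eqI)
    fix m
    have "mcoeff (1 * f) m = (\<Sum>(a, b) \<in> {(a, b). a + b = m}. (if a = 0 then 1 else 0) * mcoeff f b)"
      by (simp add: times_mfps.rep_eq one_mfps.rep_eq)
    also have "\<dots> = (\<Sum>(a, b) \<in> {(0 :: 'a \<Rightarrow>\<^sub>0 nat, m)}. (if a = 0 then 1 else 0) * mcoeff f b)"
      by (rule sum.mono_neutral_right) (auto simp: finite_antidiag split: if_splits)
    finally show "mcoeff (1 * f) m = mcoeff f m" by simp
  qed
  show "(f + g) * h = f * h + g * h"
    by (rule mfps_eqI)
       (simp add: times_mfps.rep_eq plus_mfps.rep_eq distrib_right case_prod_unfold sum.distrib)
  show "(0::'a mfps) \<noteq> 1"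
    by transfer (metis zero_neq_one)
qed (transfer; simp add: fun_eq_iff)+

end

instantiation mfps :: (finite) real_algebra_1
begin

lift_definition scaleR_mfps :: "real \<Rightarrow> 'a mfps \<Rightarrow> 'a mfps" is "\<lambda>c f m. c * f m" .

instance
proof
  fix c :: real and f g :: "'a mfps"
  show "c *\<^sub>R f * g = c *\<^sub>R (f * g)" "f * c *\<^sub>R g = c *\<^sub>R (f * g)"
    by (transfer; auto simp: fun_eq_iff sum_distrib_left intro!: sum.cong)+
qed (transfer; simp add: algebra_simps)+

end

definition mdeg :: "('n::finite \<Rightarrow>\<^sub>0 nat) \<Rightarrow> nat" where
  "mdeg m = (\<Sum>i\<in>UNIV. Poly_Mapping.lookup m i)"

lemma finite_mdeg: "finite {m :: 'n::finite \<Rightarrow>\<^sub>0 nat. mdeg m = d}"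
proof -
  let ?A = "{m :: 'n \<Rightarrow>\<^sub>0 nat. mdeg m = d}"
  have "Poly_Mapping.lookup m i \<le> mdeg m" for m :: "'n \<Rightarrow>\<^sub>0 nat" and i
    unfolding mdeg_def by (rule member_le_sum) auto
  hence "Poly_Mapping.lookup ` ?A \<subseteq> PiE UNIV (\<lambda>i. {..d})"
    by (force simp: PiE_iff)
  hence "finite (Poly_Mapping.lookup ` ?A)"
    by (rule finite_subset) (simp add: finite_PiE)
  thus ?thesis
    by (rule finite_imageD) (simp add: inj_on_def Poly_Mapping.lookup_inject)
qed

lemma mfps_leading_exponent:
  fixes f :: "'n::{finite,linorder} mfps"
  assumes "f \<noteq> 0"
  shows "\<exists>m. mcoeff f m \<noteq> 0 \<and>
    (\<forall>a. mcoeff f a \<noteq> 0 \<longrightarrow> mdeg m < mdeg a \<or> mdeg m = mdeg a \<and> m \<le> a)"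
proof -
  from assms have ex: "\<exists>d m. mcoeff f m \<noteq> 0 \<and> mdeg m = d"
    by (metis mfps_eqI zero_mfps.rep_eq)
  define d where "d = (LEAST d. \<exists>m. mcoeff f m \<noteq> 0 \<and> mdeg m = d)"
  define M where "M = {m. mcoeff f m \<noteq> 0 \<and> mdeg m = d}"
  have "M \<noteq> {}" using LeastI_ex[OF ex] unfolding M_def d_def by blast
  moreover have "finite M"
    by (rule finite_subset[OF _ finite_mdeg[of d]]) (auto simp: M_def)
  ultimately have "Min M \<in> M" and min: "\<And>a. a \<in> M \<Longrightarrow> Min M \<le> a"
    by simp_all
  moreover have "d \<le> mdeg a" if "mcoeff f a \<noteq> 0" for a
    unfolding d_def using that by (intro Least_le) blast
  ultimately show ?thesis
    by (intro exI[of _ "Min M"]) (auto simp: M_def order.order_iff_strict)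
qed

instance mfps :: ("{finite,linorder}") idom
proof
  fix f g :: "'a mfps"
  assume "f \<noteq> 0" "g \<noteq> 0"
  obtain m where m: "mcoeff f m \<noteq> 0"
    "\<And>a. mcoeff f a \<noteq> 0 \<Longrightarrow> mdeg m < mdeg a \<or> mdeg m = mdeg a \<and> m \<le> a"
    using mfps_leading_exponent[OF \<open>f \<noteq> 0\<close>] by blast
  obtain k where k: "mcoeff g k \<noteq> 0"
    "\<And>a. mcoeff g a \<noteq> 0 \<Longrightarrow> mdeg k < mdeg a \<or> mdeg k = mdeg a \<and> k \<le> a"
    using mfps_leading_exponent[OF \<open>g \<noteq> 0\<close>] by blast
  have uniq: "a = m \<and> b = k" if "a + b = m + k" "mcoeff f a \<noteq> 0" "mcoeff g b \<noteq> 0" for a b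
  proof -
    have "mdeg a + mdeg b = mdeg m + mdeg k"
      using that(1) by (simp add: mdeg_def sum.distrib[symmetric] lookup_add[symmetric])
    with m(2)[OF that(2)] k(2)[OF that(3)] have "m \<le> a" "k \<le> b" by auto
    with that(1) show ?thesis
      by (metis add_less_le_mono add_le_less_mono order.not_eq_order_implies_strict less_irrefl)
  qed
  have "mcoeff (f * g) (m + k) =
    (\<Sum>(a, b) \<in> {(a, b). a + b = m + k}. mcoeff f a * mcoeff g b)"
    by (simp add: times_mfps.rep_eq)
  also have "\<dots> = (\<Sum>(a, b) \<in> {(m, k)}. mcoeff f a * mcoeff g b)"
    by (rule sum.mono_neutral_right) (use uniq in \<open>auto simp: finite_antidiag\<close>)
  also have "\<dots> \<noteq> 0" using m(1) k(1) by simp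
  finally show "f * g \<noteq> 0"
    by (metis zero_mfps.rep_eq)
qed

text \<open>A homogeneous power series is automatically a polynomial, as there are only finitely
  many exponents of a given degree.\<close>

definition homogeneous :: "nat \<Rightarrow> 'n::finite mfps set" where
  "homogeneous r = {f. \<forall>m. mcoeff f m \<noteq> 0 \<longrightarrow> mdeg m = r}"


section \<open>Partial derivatives\<close>

lift_definition mfps_pd :: "'n \<Rightarrow> 'n mfps \<Rightarrow> 'n mfps"
  is "\<lambda>s f m. real (Poly_Mapping.lookup m s + 1) * f (m + Poly_Mapping.single s 1)" .

lemma mfps_pd_mult:
  fixes f g :: "'n::finite mfps"
  shows "mfps_pd s (f * g) = mfps_pd s f * g + f * mfps_pd s g"
proof (rule mfps_eqI)
  fix m
  let ?e = "Poly_Mapping.single s (1::nat)"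
  let ?A = "{(a, b). a + b = m + ?e}"
  have sub: "a - ?e + ?e = a" if "Poly_Mapping.lookup a s \<noteq> 0" for a
    by (rule poly_mapping_eqI) (use that in \<open>auto simp: lookup_add lookup_minus lookup_single when_def\<close>)
  have sub': "Poly_Mapping.single s (Suc 0) + (a - Poly_Mapping.single s (Suc 0)) = a"
    if "Poly_Mapping.lookup a s > 0" for a
    using sub[of a] that by (simp add: add.commute)
  have *: "(\<Sum>(a, b) \<in> ?A. real (Poly_Mapping.lookup a s) * F a b) =
      (\<Sum>(a, b) \<in> {(a, b). a + b = m}. real (Poly_Mapping.lookup a s + 1) * F (a + ?e) b)" for F
  proof -
    have "(\<Sum>(a, b) \<in> ?A. real (Poly_Mapping.lookup a s) * F a b) =
        (\<Sum>(a, b) \<in> {p \<in> ?A. Poly_Mapping.lookup (fst p) s \<noteq> 0}. real (Poly_Mapping.lookup a s) * F a b)"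
      by (rule sum.mono_neutral_right) (auto simp: finite_antidiag)
    also have "\<dots> = (\<Sum>(a, b) \<in> {(a, b). a + b = m}. real (Poly_Mapping.lookup a s + 1) * F (a + ?e) b)"
    proof (rule sum.reindex_bij_witness[where
          i = "\<lambda>(a, b). (a + ?e, b)" and j = "\<lambda>(a, b). (a - ?e, b)"], goal_cases)
      case (2 p)
      then obtain a b where p: "p = (a, b)" "a + b = m + ?e" "Poly_Mapping.lookup a s \<noteq> 0" by auto
      have "(a - ?e + b) + ?e = m + ?e"
        using sub[OF p(3)] p(2) by (metis add.assoc add.commute)
      thus ?case using p(1) by simp
    qed (auto simp: sub' lookup_add lookup_minus lookup_single ac_simps)
    finally show ?thesis .
  qed
  have sw: "(\<Sum>(a, b) \<in> {(a, b). a + b = k}. G a b) = (\<Sum>(a, b) \<in> {(a, b). a + b = k}. G b a)"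
    for k :: "'n \<Rightarrow>\<^sub>0 nat" and G :: "_ \<Rightarrow> _ \<Rightarrow> real"
    by (rule sum.reindex_bij_witness[where i = prod.swap and j = prod.swap])
       (auto simp: add.commute)
  have "mcoeff (mfps_pd s (f * g)) m =
      (\<Sum>(a, b) \<in> ?A. real (Poly_Mapping.lookup m s + 1) * (mcoeff f a * mcoeff g b))"
    by (simp add: mfps_pd.rep_eq times_mfps.rep_eq sum_distrib_left case_prod_unfold)
  also have "\<dots> = (\<Sum>(a, b) \<in> ?A. real (Poly_Mapping.lookup a s) * (mcoeff f a * mcoeff g b) +
      real (Poly_Mapping.lookup b s) * (mcoeff f a * mcoeff g b))"
  proof (rule sum.cong, rule refl, clarify)
    fix a b assume "a + b = m + ?e"
    hence "Poly_Mapping.lookup (a + b) s = Poly_Mapping.lookup (m + ?e) s" by simp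
    hence "Poly_Mapping.lookup m s + 1 = Poly_Mapping.lookup a s + Poly_Mapping.lookup b s" by (simp add: lookup_add)
    thus "real (Poly_Mapping.lookup m s + 1) * (mcoeff f a * mcoeff g b) =
      real (Poly_Mapping.lookup a s) * (mcoeff f a * mcoeff g b) + real (Poly_Mapping.lookup b s) * (mcoeff f a * mcoeff g b)"
      by (simp only: of_nat_add distrib_right)
  qed
  also have "\<dots> = (\<Sum>(a, b) \<in> ?A. real (Poly_Mapping.lookup a s) * (mcoeff f a * mcoeff g b)) +
      (\<Sum>(a, b) \<in> ?A. real (Poly_Mapping.lookup a s) * (mcoeff f b * mcoeff g a))"
    by (subst (3) sw) (simp add: case_prod_unfold sum.distrib)
  also have "\<dots> = mcoeff (mfps_pd s f * g + f * mfps_pd s g) m"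
    unfolding * plus_mfps.rep_eq times_mfps.rep_eq mfps_pd.rep_eq
    by (subst (3) sw) (simp add: case_prod_unfold ac_simps)
  finally show "mcoeff (mfps_pd s (f * g)) m = mcoeff (mfps_pd s f * g + f * mfps_pd s g) m" .
qed

definition fract_pd :: "'n::{finite,linorder} \<Rightarrow> 'n mfps fract \<Rightarrow> 'n mfps fract" where
  "fract_pd s q = (THE d. \<forall>f g. g \<noteq> 0 \<longrightarrow> q = Fract f g \<longrightarrow>
     d = Fract (mfps_pd s f * g - f * mfps_pd s g) (g * g))"

lemma fract_pd_Fract:
  assumes "g \<noteq> 0"
  shows "fract_pd s (Fract f g) = Fract (mfps_pd s f * g - f * mfps_pd s g) (g * g)"
  unfolding fract_pd_def
proof (rule the_equality)
  show "\<forall>f' g'. g' \<noteq> 0 \<longrightarrow> Fract f g = Fract f' g' \<longrightarrow>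
    Fract (mfps_pd s f * g - f * mfps_pd s g) (g * g) =
    Fract (mfps_pd s f' * g' - f' * mfps_pd s g') (g' * g')"
  proof (intro allI impI)
    fix f' g' assume nz: "g' \<noteq> 0" and "Fract f g = Fract f' g'"
    with assms have eq: "f * g' = f' * g" by (simp add: eq_fract)
    have "mfps_pd s f * g' + f * mfps_pd s g' = mfps_pd s f' * g + f' * mfps_pd s g"
      using arg_cong[OF eq, of "mfps_pd s"] by (simp add: mfps_pd_mult)
    moreover have "(mfps_pd s f * g - f * mfps_pd s g) * (g' * g') -
        (mfps_pd s f' * g' - f' * mfps_pd s g') * (g * g) =
        g * g' * ((mfps_pd s f * g' + f * mfps_pd s g') - (mfps_pd s f' * g + f' * mfps_pd s g)) -
        (f * g' - f' * g) * (g' * mfps_pd s g + g * mfps_pd s g')"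
      by (simp add: algebra_simps)
    ultimately have "(mfps_pd s f * g - f * mfps_pd s g) * (g' * g') =
        (mfps_pd s f' * g' - f' * mfps_pd s g') * (g * g)"
      using eq by simp
    with assms nz show "Fract (mfps_pd s f * g - f * mfps_pd s g) (g * g) =
        Fract (mfps_pd s f' * g' - f' * mfps_pd s g') (g' * g')"
      by (simp add: eq_fract)
  qed
qed (use assms in blast)

instantiation fract :: ("{idom,real_algebra_1}") real_vector
begin

definition scaleR_fract :: "real \<Rightarrow> 'a fract \<Rightarrow> 'a fract" where
  "scaleR_fract c q = to_fract (of_real c) * q"

instance
  by standard (simp_all add: scaleR_fract_def algebra_simps)

end


section \<open>Multivector fields and the Schouten-Nijenhuis bracket\<close>

text \<open>
  Multivector fields whose coefficients lie in the fraction field of the formal power series: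
  \<open>u $ {j\<^sub>1 < \<dots> < j\<^sub>p}\<close> is the coefficient of
  \<open>\<partial>\<^bsub>j\<^sub>1\<^esub> \<and> \<dots> \<and> \<partial>\<^bsub>j\<^sub>p\<^esub>\<close>. The library multiplication of
  vectors is componentwise and plays no role here; the exterior product is \<open>wedge\<close>.
\<close>

type_synonym 'n mvf = "(('n mfps) fract, 'n set) vec"

definition wedge :: "'n::{finite,linorder} mvf \<Rightarrow> 'n mvf \<Rightarrow> 'n mvf" where
  "wedge u v = (\<chi> K. \<Sum>I\<in>Pow K. (-1) ^ card {(i, j). i \<in> I \<and> j \<in> K - I \<and> j < i} * u $ I * v $ (K - I))"

definition mvf_pd :: "'n::{finite,linorder} \<Rightarrow> 'n mvf \<Rightarrow> 'n mvf" where
  "mvf_pd s u = (\<chi> J. fract_pd s (u $ J))"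

text \<open>Left and right derivatives with respect to the generator \<open>\<partial>\<^sub>s\<close> of the exterior algebra:
  they map \<open>\<partial>\<^sub>s \<and> w\<close>, respectively \<open>w \<and> \<partial>\<^sub>s\<close>, to \<open>w\<close> whenever \<open>w\<close> does not involve \<open>\<partial>\<^sub>s\<close>.\<close>

definition left_deriv :: "'n::{finite,linorder} \<Rightarrow> 'n mvf \<Rightarrow> 'n mvf" where
  "left_deriv s u = (\<chi> K. if s \<in> K then 0 else (-1) ^ card {j \<in> K. j < s} * u $ insert s K)"

definition right_deriv :: "'n::{finite,linorder} \<Rightarrow> 'n mvf \<Rightarrow> 'n mvf" where
  "right_deriv s u = (\<chi> K. if s \<in> K then 0 else (-1) ^ card {j \<in> K. s < j} * u $ insert s K)"

text \<open>The coordinate expression of the bracket, in the sign convention for which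
  \<open>[u, v \<and> w] = [u, v] \<and> w + (-1)\<^bsup>(a-1)b\<^esup> v \<and> [u, w]\<close> with \<open>a\<close>, \<open>b\<close> the degrees of \<open>u\<close>, \<open>v\<close>,
  \<open>[X, f] = X f\<close> and \<open>[X, Y]\<close> the Lie bracket for vector fields \<open>X\<close>, \<open>Y\<close> and functions \<open>f\<close>.\<close>

definition sn_bracket :: "'n::{finite,linorder} mvf \<Rightarrow> 'n mvf \<Rightarrow> 'n mvf" where
  "sn_bracket u v = (\<Sum>s\<in>UNIV. wedge (right_deriv s u) (mvf_pd s v) - wedge (mvf_pd s u) (left_deriv s v))"

definition vector_field :: "('n::{finite,linorder} \<Rightarrow> 'n mfps fract) \<Rightarrow> 'n mvf" where
  "vector_field X = (\<Sum>s\<in>UNIV. X s *s axis {s} 1)"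

lemma vector_field_nth:
  "vector_field X $ J = (if card J = 1 then X (the_elem J) else 0)"
proof -
  have "vector_field X $ J = (\<Sum>s\<in>UNIV. if J = {s} then X s else 0)"
    by (auto simp: vector_field_def axis_def intro!: sum.cong)
  also have "\<dots> = (if card J = 1 then X (the_elem J) else 0)"
    by (auto simp: card_1_singleton_iff intro!: sum.neutral)
  finally show ?thesis .
qed

lemma fract_pd_0: "fract_pd s 0 = 0"
proof -
  have "mfps_pd s 0 = 0" by transfer simp
  thus ?thesis by (simp add: Zero_fract_def fract_pd_Fract)
qed

lemma sn_bracket_vector_field:
  "sn_bracket (vector_field X) (vector_field Y) =
   vector_field (\<lambda>t. \<Sum>s\<in>UNIV. X s * fract_pd s (Y t) - Y s * fract_pd s (X t))"
proof (unfold vec_eq_iff, rule allI)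
  fix K
  have R: "right_deriv s (vector_field Z) = axis {} (Z s)"
    "left_deriv s (vector_field Z) = axis {} (Z s)" for s and Z :: "'a \<Rightarrow> 'a mfps fract"
    by (auto simp: right_deriv_def left_deriv_def vector_field_nth vec_eq_iff axis_def)
  have W1: "wedge (axis {} c) u $ K = c * u $ K" for c and u :: "'a mvf"
  proof -
    have "wedge (axis {} c) u $ K = (\<Sum>I\<in>{{} :: 'a set}. c * u $ K)"
      unfolding wedge_def vec_lambda_beta
      by (rule sum.mono_neutral_cong_right) (auto simp: axis_def)
    thus ?thesis by simp
  qed
  have W2: "wedge u (axis {} c) $ K = u $ K * c" for c and u :: "'a mvf"
  proof -
    have "wedge u (axis {} c) $ K = (\<Sum>I\<in>{K}. u $ K * c)"
      unfolding wedge_def vec_lambda_beta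
      by (rule sum.mono_neutral_cong_right) (auto simp: axis_def)
    thus ?thesis by simp
  qed
  show "sn_bracket (vector_field X) (vector_field Y) $ K =
    vector_field (\<lambda>t. \<Sum>s\<in>UNIV. X s * fract_pd s (Y t) - Y s * fract_pd s (X t)) $ K"
    by (simp add: sn_bracket_def R W1 W2 mvf_pd_def vector_field_nth fract_pd_0 mult.commute)
qed


section \<open>Real vector spaces as modules\<close>

text \<open>Only carrier, addition, zero and scalar multiplication of a module record matter here.\<close>

definition vspace :: "'v::real_vector set \<Rightarrow> (real, 'v) module" where
  "vspace S = \<lparr>carrier = S, mult = undefined, one = undefined, zero = 0, add = (+), smult = (*\<^sub>R)\<rparr>"

definition quot_module :: "('a, 'v) module \<Rightarrow> 'v set \<Rightarrow> ('a, 'v set) module" where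
  "quot_module M N =
    \<lparr>carrier = a_rcosets\<^bsub>M\<^esub> N, mult = undefined, one = undefined, zero = N, add = set_add M,
     smult = (\<lambda>a X. \<Union>x\<in>X. N +>\<^bsub>M\<^esub> (a \<odot>\<^bsub>M\<^esub> x))\<rparr>"

definition dsum_module :: "('a, 'v) module \<Rightarrow> ('a, 'w) module \<Rightarrow> ('a, 'v \<times> 'w) module" where
  "dsum_module M N =
    \<lparr>carrier = carrier M \<times> carrier N, mult = undefined, one = undefined, zero = (\<zero>\<^bsub>M\<^esub>, \<zero>\<^bsub>N\<^esub>),
     add = (\<lambda>(x, y) (x', y'). (x \<oplus>\<^bsub>M\<^esub> x', y \<oplus>\<^bsub>N\<^esub> y')),
     smult = (\<lambda>a (x, y). (a \<odot>\<^bsub>M\<^esub> x, a \<odot>\<^bsub>N\<^esub> y))\<rparr>"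

definition lin_maps :: "(real, 'v) module \<Rightarrow> (real, 'w) module \<Rightarrow> ('v \<Rightarrow> 'w) set" where
  "lin_maps M N = {h \<in> carrier M \<rightarrow> carrier N.
     (\<forall>x\<in>carrier M. \<forall>y\<in>carrier M. h (x \<oplus>\<^bsub>M\<^esub> y) = h x \<oplus>\<^bsub>N\<^esub> h y) \<and>
     (\<forall>a. \<forall>x\<in>carrier M. h (a \<odot>\<^bsub>M\<^esub> x) = a \<odot>\<^bsub>N\<^esub> h x)}"

definition lin_iso :: "(real, 'v) module \<Rightarrow> (real, 'w) module \<Rightarrow> bool" (infix \<open>\<cong>\<^sub>\<real>\<close> 50) where
  "M \<cong>\<^sub>\<real> N \<longleftrightarrow> (\<exists>h\<in>lin_maps M N. bij_betw h (carrier M) (carrier N))"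

text \<open>The value on a coset of the map induced by \<open>h\<close> on quotients, for target \<open>M / N\<close>.\<close>

definition induced :: "('a, 'w) module \<Rightarrow> 'w set \<Rightarrow> ('v \<Rightarrow> 'w) \<Rightarrow> 'v set \<Rightarrow> 'w set" where
  "induced M N h X = (\<Union>x\<in>X. N +>\<^bsub>M\<^esub> h x)"

definition coboundaries :: "(int \<Rightarrow> (real, 'v) module) \<Rightarrow> (int \<Rightarrow> 'v \<Rightarrow> 'v) \<Rightarrow> int \<Rightarrow> 'v set" where
  "coboundaries C d p = d (p - 1) ` carrier (C (p - 1))"

definition cohomology ::
    "(int \<Rightarrow> (real, 'v) module) \<Rightarrow> (int \<Rightarrow> 'v \<Rightarrow> 'v) \<Rightarrow> int \<Rightarrow> (real, 'v set) module" where
  "cohomology C d p =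
     quot_module (C p\<lparr>carrier := a_kernel (C p) (C (p + 1)) (d p)\<rparr>) (coboundaries C d p)"


section \<open>Formal and potential cochains\<close>

text \<open>In this section \<open>l\<close> is the matrix of linear forms of the fields
  \<open>Y\<^sub>i = \<Sum>\<^sub>s l\<^sub>i\<^sub>s \<partial>\<^sub>s\<close> and \<open>D = det l\<close>. Degrees \<open>p\<close> are integers; the components of
  negative degree are \<open>{0}\<close>.\<close>

type_synonym 'n mfps_matrix = "(('n mfps, 'n) vec, 'n) vec"

definition lin_field :: "'n::{finite,linorder} mfps_matrix \<Rightarrow> 'n \<Rightarrow> 'n mvf" where
  "lin_field l i = vector_field (\<lambda>s. to_fract (l $ i $ s))"

definition lin_field_wedge :: "'n::{finite,linorder} mfps_matrix \<Rightarrow> 'n set \<Rightarrow> 'n mvf" where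
  "lin_field_wedge l I = foldr wedge (map (lin_field l) (sorted_list_of_set I)) (axis {} 1)"

definition formal_cochains :: "'n::{finite,linorder} mvf set" where
  "formal_cochains = {c. \<forall>J. c $ J \<in> range to_fract}"

text \<open>The bihomogeneous components \<open>\<P>\<^sup>p\<^sup>r\<close> and \<open>\<R>\<^sup>p\<^sup>r = \<R> \<inter> \<P>\<^sup>p\<^sup>r\<close>. Since both kinds of cochains
  are realised inside the same space of multivector fields, the canonical inclusion of formal into
  potential cochains is set inclusion.\<close>

definition Pcomp :: "'n::{finite,linorder} mfps_matrix \<Rightarrow> nat \<Rightarrow> int \<Rightarrow> 'n mvf set" where
  "Pcomp l r p =
    {inverse (to_fract (det l)) *s (\<Sum>I | int (card I) = p. to_fract (f I) *s lin_field_wedge l I)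
     | f. \<forall>I. f I \<in> homogeneous r}"

definition Rcomp :: "'n::{finite,linorder} mfps_matrix \<Rightarrow> nat \<Rightarrow> int \<Rightarrow> 'n mvf set" where
  "Rcomp l r p = formal_cochains \<inter> Pcomp l r p"

definition Pcplx :: "'n::{finite,linorder} mfps_matrix \<Rightarrow> nat \<Rightarrow> int \<Rightarrow> (real, 'n mvf) module" where
  "Pcplx l r p = vspace (Pcomp l r p)"

definition Rcplx :: "'n::{finite,linorder} mfps_matrix \<Rightarrow> nat \<Rightarrow> int \<Rightarrow> (real, 'n mvf) module" where
  "Rcplx l r p = vspace (Rcomp l r p)"

definition PRcplx :: "'n::{finite,linorder} mfps_matrix \<Rightarrow> nat \<Rightarrow> int \<Rightarrow> (real, 'n mvf set) module" where
  "PRcplx l r p = quot_module (Pcplx l r p) (Rcomp l r p)"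

definition PRdiff ::
    "'n::{finite,linorder} mfps_matrix \<Rightarrow> 'n mvf \<Rightarrow> nat \<Rightarrow> int \<Rightarrow> 'n mvf set \<Rightarrow> 'n mvf set" where
  "PRdiff l \<Lambda> r p = induced (Pcplx l r (p + 1)) (Rcomp l r (p + 1)) (sn_bracket \<Lambda>)"

definition LH_P :: "'n::{finite,linorder} mfps_matrix \<Rightarrow> 'n mvf \<Rightarrow> nat \<Rightarrow> int \<Rightarrow> (real, 'n mvf set) module"
  where "LH_P l \<Lambda> r = cohomology (Pcplx l r) (\<lambda>_. sn_bracket \<Lambda>)"

definition LH_R :: "'n::{finite,linorder} mfps_matrix \<Rightarrow> 'n mvf \<Rightarrow> nat \<Rightarrow> int \<Rightarrow> (real, 'n mvf set) module"
  where "LH_R l \<Lambda> r = cohomology (Rcplx l r) (\<lambda>_. sn_bracket \<Lambda>)"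

definition LH_PR ::
    "'n::{finite,linorder} mfps_matrix \<Rightarrow> 'n mvf \<Rightarrow> nat \<Rightarrow> int \<Rightarrow> (real, 'n mvf set set) module"
  where "LH_PR l \<Lambda> r = cohomology (PRcplx l r) (PRdiff l \<Lambda> r)"

text \<open>The natural map from \<^const>\<open>LH_P\<close> to \<^const>\<open>LH_PR\<close>.\<close>

definition natural_map ::
    "'n::{finite,linorder} mfps_matrix \<Rightarrow> 'n mvf \<Rightarrow> nat \<Rightarrow> int \<Rightarrow> 'n mvf set \<Rightarrow> 'n mvf set set" where
  "natural_map l \<Lambda> r p =
     induced (PRcplx l r p) (coboundaries (PRcplx l r) (PRdiff l \<Lambda> r) p)
       (\<lambda>c. Rcomp l r p +>\<^bsub>Pcplx l r p\<^esub> c)"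

text \<open>The connecting homomorphism. A relative class is a set of cosets of \<open>\<R>\<^sup>p\<^sup>r\<close> in \<open>\<P>\<^sup>p\<^sup>r\<close>, so its
  representatives in \<open>\<P>\<^sup>p\<^sup>r\<close> form the union of these cosets.\<close>

definition connecting ::
    "'n::{finite,linorder} mfps_matrix \<Rightarrow> 'n mvf \<Rightarrow> nat \<Rightarrow> int \<Rightarrow> 'n mvf set set \<Rightarrow> 'n mvf set" where
  "connecting l \<Lambda> r p X =
     induced (Rcplx l r (p + 1)) (coboundaries (Rcplx l r) (\<lambda>_. sn_bracket \<Lambda>) (p + 1))
       (sn_bracket \<Lambda>) (\<Union>X)"

definition ker_connecting ::
    "'n::{finite,linorder} mfps_matrix \<Rightarrow> 'n mvf \<Rightarrow> nat \<Rightarrow> int \<Rightarrow> 'n mvf set set set" where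
  "ker_connecting l \<Lambda> r p = a_kernel (LH_PR l \<Lambda> r p) (LH_R l \<Lambda> r (p + 1)) (connecting l \<Lambda> r p)"

text \<open>Linear sections of the natural map over its image, which by exactness is the kernel of the
  connecting homomorphism.\<close>

definition sections ::
    "'n::{finite,linorder} mfps_matrix \<Rightarrow> 'n mvf \<Rightarrow> nat \<Rightarrow> int \<Rightarrow> ('n mvf set set \<Rightarrow> 'n mvf set) set" where
  "sections l \<Lambda> r p =
     {\<sigma> \<in> lin_maps (LH_PR l \<Lambda> r p\<lparr>carrier := ker_connecting l \<Lambda> r p\<rparr>) (LH_P l \<Lambda> r p).
        \<forall>X\<in>ker_connecting l \<Lambda> r p. natural_map l \<Lambda> r p (\<sigma> X) = X}"

end

theory Submission
  imports Defs
begin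

text \<open>
  Since \<open>L\<^sub>Y Y\<^sub>I = 0\<close> for each field \<open>Y = Y\<^sub>i\<close>, the operator \<open>[\<Lambda>, \<cdot>]\<close> only differentiates coefficients:
  \<open>[Y\<^sub>i \<and> Y\<^sub>j, g Y\<^sub>I] = Y\<^sub>j(g) Y\<^sub>i \<and> Y\<^sub>I - Y\<^sub>i(g) Y\<^sub>j \<and> Y\<^sub>I\<close>. By Jacobi's formula \<open>Y\<^sub>i(D) = div(Y\<^sub>i) D\<close> with
  constant divergence, so coefficients \<open>f / D\<close> with \<open>f\<close> homogeneous of degree \<open>r\<close> keep that shape, and
  \<open>(\<P>, \<R>)\<close> is a pair of complexes.

  The rest is linear algebra. The classes in \<open>LH(\<P>)\<close> killed by the natural map to relative
  cohomology are those with a representative in \<open>\<R>\<close>, and they form a complement of the image of any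
  section. Hence, with \<open>Z\<close> the cocycles of \<open>\<R>\<close>, the first summand is \<open>Z / (Z \<inter> d\<P>)\<close>. Applying \<open>d\<close> to
  representatives identifies the second summand with \<open>(Z \<inter> d\<P>) / d\<R>\<close>, and a linear projection of \<open>Z\<close>
  onto \<open>Z \<inter> d\<P>\<close> splits \<open>Z / d\<R>\<close> accordingly.
\<close>

section \<open>Presentations of real modules by subspaces\<close>

text \<open>Relative classes are cosets of cosets, so maps on them are hard to define and compare
  directly. Each module is therefore treated as \<open>S / N\<close> for subspaces
  \<open>N \<subseteq> S\<close> of one real vector space, and membership in \<open>S\<close> and
  \<open>N\<close> replaces equality of classes. Complements come from linear left inverses on
  subspaces, which exist in any real vector space. The first component of the final isomorphism
  sends a cocycle of \<open>R\<close> to its own class; the second inverts \<open>d\<close> on the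
  projected part, where \<open>d y\<close> fixes \<open>y\<close> up to a cocycle of
  \<open>P\<close>, whose relative class the connecting homomorphism kills. The ambient space also
  serves the geometry: the bracket with \<Lambda> is an operator on all multivector fields, so any
  expression of a potential cochain through \<open>f_I / D\<close> and \<open>Y_I\<close> may be
  used to evaluate it. Its square vanishes by direct computation on these terms, where the
  derivations on numerators commute because the fields do and their divergences are
  constant.\<close>

text \<open>All modules below are cosets, or cosets of cosets, of vectors; \<open>\<pi>\<close> sends a representative
  in \<open>S\<close> to its class, so that computations take place in the ambient vector space.\<close>

definition presents :: "(real, 'x) module \<Rightarrow> 'v::real_vector set \<Rightarrow> 'v set \<Rightarrow> ('v \<Rightarrow> 'x) \<Rightarrow> bool" where
  "presents M S N \<pi> \<longleftrightarrow> subspace S \<and> subspace N \<and> N \<subseteq> S \<and> \<pi> ` S = carrier M \<and>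
     (\<forall>x\<in>S. \<forall>y\<in>S. \<pi> (x + y) = \<pi> x \<oplus>\<^bsub>M\<^esub> \<pi> y) \<and>
     (\<forall>a. \<forall>x\<in>S. \<pi> (a *\<^sub>R x) = a \<odot>\<^bsub>M\<^esub> \<pi> x) \<and>
     (\<forall>x\<in>S. \<pi> x = \<zero>\<^bsub>M\<^esub> \<longleftrightarrow> x \<in> N)"

lemma presentsD:
  assumes "presents M S N \<pi>"
  shows "subspace S" "subspace N" "N \<subseteq> S" "\<pi> ` S = carrier M"
    "\<And>x y. x \<in> S \<Longrightarrow> y \<in> S \<Longrightarrow> \<pi> (x + y) = \<pi> x \<oplus>\<^bsub>M\<^esub> \<pi> y"
    "\<And>a x. x \<in> S \<Longrightarrow> \<pi> (a *\<^sub>R x) = a \<odot>\<^bsub>M\<^esub> \<pi> x"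
    "\<And>x. x \<in> S \<Longrightarrow> \<pi> x = \<zero>\<^bsub>M\<^esub> \<longleftrightarrow> x \<in> N"
  using assms unfolding presents_def by auto

lemma presents_zero:
  assumes "presents M S N \<pi>"
  shows "\<pi> 0 = \<zero>\<^bsub>M\<^esub>"
  using presentsD(7)[OF assms, of 0] presentsD(1,2)[OF assms] by (simp add: subspace_0)

lemma presents_eq_iff:
  assumes M: "presents M S N \<pi>" and x: "x \<in> S" and y: "y \<in> S"
  shows "\<pi> x = \<pi> y \<longleftrightarrow> x - y \<in> N"
proof
  note S = presentsD(1)[OF M]
  have d: "x - y \<in> S" using S x y by (rule subspace_diff)
  have m: "- y \<in> S" using S y by (rule subspace_neg)
  {
    assume "\<pi> x = \<pi> y"
    then have "\<pi> (x + - y) = \<pi> (y + - y)"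
      by (simp only: presentsD(5)[OF M x m] presentsD(5)[OF M y m])
    then show "x - y \<in> N"
      using presentsD(7)[OF M d] presents_zero[OF M] by simp
  next
    assume "x - y \<in> N"
    then have "\<pi> (x - y) = \<pi> 0"
      using presentsD(7)[OF M d] presents_zero[OF M] by simp
    then have "\<pi> (y + (x - y)) = \<pi> (y + 0)"
      by (simp only: presentsD(5)[OF M y d] presentsD(5)[OF M y subspace_0[OF S]])
    then show "\<pi> x = \<pi> y" by simp
  }
qed

lemma presents_vspace:
  "subspace S \<Longrightarrow> presents (vspace S) S {0} (\<lambda>x. x)"
  unfolding presents_def vspace_def by (auto simp: subspace_0 subspace_single_0)

lemma presents_sub:
  assumes "presents M S N \<pi>" "subspace T" "N \<subseteq> T" "T \<subseteq> S"
  shows "presents (M\<lparr>carrier := \<pi> ` T\<rparr>) T N \<pi>"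
  using assms unfolding presents_def by (auto simp: subset_eq)

lemma presents_coset:
  assumes M: "presents M S N \<pi>" and T: "subspace T" "T \<subseteq> S" and x: "x \<in> S"
  shows "(\<pi> ` T) +>\<^bsub>M\<^esub> \<pi> x = \<pi> ` {y. y - x \<in> T}"
proof -
  have "\<pi> t \<oplus>\<^bsub>M\<^esub> \<pi> x = \<pi> (t + x)" if "t \<in> T" for t
    using presentsD(5)[OF M] T x that by auto
  then have "(\<pi> ` T) +>\<^bsub>M\<^esub> \<pi> x = \<pi> ` ((\<lambda>t. t + x) ` T)"
    by (auto simp: a_r_coset_def' image_iff)
  also have "(\<lambda>t. t + x) ` T = {y. y - x \<in> T}"
    by (force simp: image_iff)
  finally show ?thesis .
qed

text \<open>Because \<open>N \<subseteq> T\<close>, the full preimage in \<open>S\<close> of the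
  image of \<open>T\<close> is \<open>T\<close> itself, so cosets can be compared by subtracting
  representatives.\<close>

lemma presents_coset_eq_iff:
  assumes M: "presents M S N \<pi>" and T: "subspace T" "N \<subseteq> T" "T \<subseteq> S" and x: "x \<in> S" and y: "y \<in> S"
  shows "(\<pi> ` T) +>\<^bsub>M\<^esub> \<pi> x = (\<pi> ` T) +>\<^bsub>M\<^esub> \<pi> y \<longleftrightarrow> x - y \<in> T"
proof
  assume "(\<pi> ` T) +>\<^bsub>M\<^esub> \<pi> x = (\<pi> ` T) +>\<^bsub>M\<^esub> \<pi> y"
  moreover have "\<pi> x \<in> \<pi> ` {z. z - x \<in> T}" using subspace_0[OF T(1)] by auto
  ultimately have "\<pi> x \<in> \<pi> ` {z. z - y \<in> T}"
    using presents_coset[OF M T(1,3)] x y by simp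
  then obtain z where z: "\<pi> x = \<pi> z" "z - y \<in> T" by auto
  have "(z - y) + y \<in> S" by (rule subspace_add[OF presentsD(1)[OF M]]) (use z(2) T y in auto)
  then have "x - z \<in> N" using presents_eq_iff[OF M x, of z] z(1) by simp
  then have "(x - z) + (z - y) \<in> T" using T z(2) subspace_add by blast
  then show "x - y \<in> T" by simp
next
  assume *: "x - y \<in> T"
  have "z - x \<in> T \<longleftrightarrow> z - y \<in> T" for z
    using subspace_add[OF T(1) _ *, of "z - x"] subspace_diff[OF T(1) _ *, of "z - y"]
    by (auto simp: algebra_simps)
  then show "(\<pi> ` T) +>\<^bsub>M\<^esub> \<pi> x = (\<pi> ` T) +>\<^bsub>M\<^esub> \<pi> y"
    using presents_coset[OF M T(1,3)] x y by simp
qed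

text \<open>The third isomorphism theorem, \<open>(S / N) / (T / N) = S / T\<close>, checked for
  each module operation on cosets.\<close>

lemma presents_quot:
  assumes M: "presents M S N \<pi>" and T: "subspace T" "N \<subseteq> T" "T \<subseteq> S"
  shows "presents (quot_module M (\<pi> ` T)) S T (\<lambda>x. (\<pi> ` T) +>\<^bsub>M\<^esub> \<pi> x)"
proof -
  note S = presentsD(1)[OF M]
  note coset = presents_coset[OF M T(1,3)]
  note coset_eq = presents_coset_eq_iff[OF M T]
  have in_S: "z \<in> S" if "z - x \<in> T" "x \<in> S" for z x
    using subspace_add[OF S, of "z - x" x] T that by auto
  show ?thesis
    unfolding presents_def
  proof (intro conjI ballI allI)
    show "(\<lambda>x. (\<pi> ` T) +>\<^bsub>M\<^esub> \<pi> x) ` S = carrier (quot_module M (\<pi> ` T))"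
      by (auto simp: quot_module_def A_RCOSETS_def' presentsD(4)[OF M, symmetric])
  next
    fix x y assume xy: "x \<in> S" "y \<in> S"
    have "(\<pi> ` T +>\<^bsub>M\<^esub> \<pi> x) \<oplus>\<^bsub>quot_module M (\<pi> ` T)\<^esub> (\<pi> ` T +>\<^bsub>M\<^esub> \<pi> y) =
        (\<Union>a\<in>{z. z - x \<in> T}. \<Union>b\<in>{z. z - y \<in> T}. {\<pi> (a + b)})"
      using presentsD(5)[OF M] in_S xy by (auto simp: quot_module_def set_add_def' coset)
    also have "\<dots> = \<pi> ` {z. z - (x + y) \<in> T}"
    proof (intro equalityI subsetI)
      fix w assume "w \<in> (\<Union>a\<in>{z. z - x \<in> T}. \<Union>b\<in>{z. z - y \<in> T}. {\<pi> (a + b)})"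
      then obtain a b where ab: "a - x \<in> T" "b - y \<in> T" "w = \<pi> (a + b)" by auto
      have "a + b - (x + y) \<in> T"
        using subspace_add[OF T(1) ab(1,2)] by (simp add: algebra_simps)
      with ab show "w \<in> \<pi> ` {z. z - (x + y) \<in> T}" by auto
    next
      fix w assume "w \<in> \<pi> ` {z. z - (x + y) \<in> T}"
      then obtain z where z: "z - (x + y) \<in> T" "w = \<pi> z" by auto
      show "w \<in> (\<Union>a\<in>{z. z - x \<in> T}. \<Union>b\<in>{z. z - y \<in> T}. {\<pi> (a + b)})"
        by (rule UN_I[of x], use subspace_0[OF T(1)] in simp, rule UN_I[of "z - x"])
           (use z in \<open>auto simp: algebra_simps\<close>)
    qed
    also have "\<dots> = \<pi> ` T +>\<^bsub>M\<^esub> \<pi> (x + y)" using coset subspace_add[OF S] xy by simp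
    finally show "\<pi> ` T +>\<^bsub>M\<^esub> \<pi> (x + y) =
        (\<pi> ` T +>\<^bsub>M\<^esub> \<pi> x) \<oplus>\<^bsub>quot_module M (\<pi> ` T)\<^esub> (\<pi> ` T +>\<^bsub>M\<^esub> \<pi> y)" by simp
  next
    fix a x assume x: "x \<in> S"
    have "\<pi> ` T +>\<^bsub>M\<^esub> (a \<odot>\<^bsub>M\<^esub> \<pi> z) = \<pi> ` T +>\<^bsub>M\<^esub> \<pi> (a *\<^sub>R x)" if "z - x \<in> T" for z
    proof -
      have "a *\<^sub>R z - a *\<^sub>R x \<in> T"
        using subspace_scale[OF T(1) that, of a] by (simp add: scaleR_diff_right)
      then have "\<pi> ` T +>\<^bsub>M\<^esub> \<pi> (a *\<^sub>R z) = \<pi> ` T +>\<^bsub>M\<^esub> \<pi> (a *\<^sub>R x)"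
        using coset_eq subspace_scale[OF S] in_S[OF that x] x by simp
      then show ?thesis using presentsD(6)[OF M] in_S[OF that x] by simp
    qed
    then have "a \<odot>\<^bsub>quot_module M (\<pi> ` T)\<^esub> (\<pi> ` T +>\<^bsub>M\<^esub> \<pi> x) =
        (\<Union>z\<in>{z. z - x \<in> T}. \<pi> ` T +>\<^bsub>M\<^esub> \<pi> (a *\<^sub>R x))"
      using x by (simp add: quot_module_def coset[OF x])
    also have "\<dots> = \<pi> ` T +>\<^bsub>M\<^esub> \<pi> (a *\<^sub>R x)"
      using subspace_0[OF T(1)] by (intro SUP_eq_const) (auto intro: exI[of _ x])
    finally show "\<pi> ` T +>\<^bsub>M\<^esub> \<pi> (a *\<^sub>R x) =
        a \<odot>\<^bsub>quot_module M (\<pi> ` T)\<^esub> (\<pi> ` T +>\<^bsub>M\<^esub> \<pi> x)" by simp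
  next
    fix x assume x: "x \<in> S"
    have "\<pi> ` T +>\<^bsub>M\<^esub> \<pi> 0 = \<pi> ` T" using coset[OF subspace_0[OF S]] by simp
    then show "\<pi> ` T +>\<^bsub>M\<^esub> \<pi> x = \<zero>\<^bsub>quot_module M (\<pi> ` T)\<^esub> \<longleftrightarrow> x \<in> T"
      using coset_eq[OF x subspace_0[OF S]] by (simp add: quot_module_def)
  qed (use S T in auto)
qed

text \<open>\<open>induced\<close> takes a union over all representatives. It is a single coset
  because \<delta> carries \<open>T\<close> into \<open>T'\<close>, so every representative
  contributes the same one.\<close>

lemma induced_presented_coset:
  assumes M: "presents M S N \<pi>" and T: "subspace T" "T \<subseteq> S"
    and M': "presents M' S' N' \<pi>'" and T': "subspace T'" "N' \<subseteq> T'" "T' \<subseteq> S'"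
    and x: "x \<in> S" and add: "\<And>y z. \<delta> (y - z) = \<delta> y - \<delta> z"
    and h: "\<And>y. y \<in> S \<Longrightarrow> h (\<pi> y) = \<pi>' (\<delta> y)"
    and S': "\<And>y. y \<in> S \<Longrightarrow> \<delta> y \<in> S'" and TT': "\<And>y. y \<in> T \<Longrightarrow> \<delta> y \<in> T'"
  shows "induced M' (\<pi>' ` T') h (\<pi> ` T +>\<^bsub>M\<^esub> \<pi> x) = \<pi>' ` T' +>\<^bsub>M'\<^esub> \<pi>' (\<delta> x)"
proof -
  have "\<pi>' ` T' +>\<^bsub>M'\<^esub> h (\<pi> y) = \<pi>' ` T' +>\<^bsub>M'\<^esub> \<pi>' (\<delta> x)" if "y - x \<in> T" for y
  proof -
    have y: "y \<in> S" using subspace_add[OF presentsD(1)[OF M], of "y - x" x] that T x by auto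
    show ?thesis
      using presents_coset_eq_iff[OF M' T' S'[OF y] S'[OF x]] TT'[OF that] h[OF y] add by simp
  qed
  moreover have "{y. y - x \<in> T} \<noteq> {}" using subspace_0[OF T(1)] by (auto intro: exI[of _ x])
  ultimately show ?thesis
    unfolding induced_def presents_coset[OF M T x] image_image
    by (intro SUP_eq_const) blast+
qed

text \<open>Working modulo \<open>N\<close> lets one result cover both a complex of vector spaces
  (\<open>N = {0}\<close>) and its quotient by a subcomplex (\<open>N\<close> the subcomplex). In
  the quotient a cocycle only has its image in \<open>N1\<close>, and adding \<open>N\<close> to the
  images makes \<open>B\<close> the full preimage of the coboundaries.\<close>

lemma presents_cohomology:
  assumes M: "presents (C p) S N \<pi>" and M1: "presents (C (p + 1)) S1 N1 \<pi>1"
    and M0: "presents (C (p - 1)) S0 N0 \<pi>0"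
    and \<delta>: "linear \<delta>"
    and h: "\<And>y. y \<in> S \<Longrightarrow> d p (\<pi> y) = \<pi>1 (\<delta> y)" "\<And>y. y \<in> S \<Longrightarrow> \<delta> y \<in> S1"
    and h0: "\<And>y. y \<in> S0 \<Longrightarrow> d (p - 1) (\<pi>0 y) = \<pi> (\<delta> y)" "\<And>y. y \<in> S0 \<Longrightarrow> \<delta> y \<in> S"
    and N: "\<And>y. y \<in> N \<Longrightarrow> \<delta> y \<in> N1" "\<And>y. y \<in> S0 \<Longrightarrow> \<delta> (\<delta> y) \<in> N1"
  defines "Z \<equiv> {x \<in> S. \<delta> x \<in> N1}" and "B \<equiv> {a + b |a b. a \<in> N \<and> b \<in> \<delta> ` S0}"
  shows "coboundaries C d p = \<pi> ` B"
    and "subspace Z" and "subspace B" and "N \<subseteq> B" and "B \<subseteq> Z"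
    and "a_kernel (C p) (C (p + 1)) (d p) = \<pi> ` Z"
    and "presents (cohomology C d p) Z B (\<lambda>x. \<pi> ` B +>\<^bsub>C p\<^esub> \<pi> x)"
proof -
  note S = presentsD[OF M] and S1 = presentsD[OF M1] and S0 = presentsD[OF M0]
  have BS: "B \<subseteq> S"
    unfolding B_def using S(1,3) h0(2) subspace_add by blast
  show B: "coboundaries C d p = \<pi> ` B"
  proof -
    have "\<pi> (a + b) = \<pi> b" if "a \<in> N" "b \<in> \<delta> ` S0" for a b
      using that S presents_eq_iff[OF M, of "a + b" b] h0(2) subspace_add[OF S(1), of a b] by auto
    then have "\<pi> ` B = \<pi> ` \<delta> ` S0"
      unfolding B_def using subspace_0[OF S(2)] by (fastforce simp: image_iff)
    also have "\<dots> = d (p - 1) ` carrier (C (p - 1))"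
      unfolding S0(4)[symmetric] using h0(1) by (force simp: image_iff)
    finally show ?thesis unfolding coboundaries_def by simp
  qed
  have "Z = S \<inter> \<delta> -` N1" by (auto simp: Z_def)
  then show sZ: "subspace Z"
    using subspace_inter[OF S(1) linear_subspace_vimage[OF \<delta> S1(2)]] by simp
  show sB: "subspace B"
    unfolding B_def by (rule subspace_sums[OF S(2) linear_subspace_image[OF \<delta> S0(1)]])
  show NB: "N \<subseteq> B"
    unfolding B_def using subspace_0[OF linear_subspace_image[OF \<delta> S0(1)]] by force
  show BZ: "B \<subseteq> Z"
    using BS N subspace_add[OF S1(2)] by (auto simp: Z_def B_def linear_add[OF \<delta>])
  show K: "a_kernel (C p) (C (p + 1)) (d p) = \<pi> ` Z"
    unfolding a_kernel_def' S(4)[symmetric] Z_def using h S1(7) by (auto simp: image_iff)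
  have NZ: "N \<subseteq> Z" and ZS: "Z \<subseteq> S" using NB BZ by (auto simp: Z_def)
  have "presents (quot_module (C p\<lparr>carrier := \<pi> ` Z\<rparr>) (\<pi> ` B)) Z B
      (\<lambda>x. \<pi> ` B +>\<^bsub>C p\<lparr>carrier := \<pi> ` Z\<rparr>\<^esub> \<pi> x)"
    by (rule presents_quot[OF presents_sub[OF M sZ NZ ZS] sB NB BZ])
  then show "presents (cohomology C d p) Z B (\<lambda>x. \<pi> ` B +>\<^bsub>C p\<^esub> \<pi> x)"
    by (simp add: cohomology_def K B a_r_coset_def')
qed

text \<open>The isomorphism sends the class of \<open>x\<close> to the classes of \<open>f x\<close>
  and of any \<open>y\<close> with \<open>\<delta> y = q x\<close>; the kernel condition on \<delta>
  makes the latter unique modulo \<open>NE\<close>. In the application \<delta> is the differential,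
  so this lift inverts the connecting homomorphism.\<close>

lemma presents_dsum_lin_iso:
  fixes M :: "(real, 'x) module" and A :: "(real, 'y) module" and E :: "(real, 'z) module"
  assumes M: "presents M S N \<pi>" and A: "presents A SA NA \<pi>A" and E: "presents E SE NE \<pi>E"
    and f: "linear f" and fS: "\<And>x. x \<in> S \<Longrightarrow> f x \<in> SA"
    and q: "linear q" and qS: "\<And>x. x \<in> S \<Longrightarrow> q x \<in> \<delta> ` SE"
    and \<delta>: "linear \<delta>" "\<And>y. y \<in> SE \<Longrightarrow> \<delta> y = 0 \<Longrightarrow> y \<in> NE"
    and inj: "\<And>x y. x \<in> S \<Longrightarrow> y \<in> SE \<Longrightarrow> q x = \<delta> y \<Longrightarrow> x \<in> N \<longleftrightarrow> f x \<in> NA \<and> y \<in> NE"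
    and surj: "\<And>a e. a \<in> SA \<Longrightarrow> e \<in> SE \<Longrightarrow> \<exists>x\<in>S. \<exists>y\<in>SE. a - f x \<in> NA \<and> q x = \<delta> y \<and> e - y \<in> NE"
  shows "M \<cong>\<^sub>\<real> dsum_module A E"
proof -
  note SM = presentsD[OF M] and SA = presentsD[OF A] and SE = presentsD[OF E]
  \<comment> \<open>A choice of preimages under \<delta> need not be linear; it becomes linear only
    after passing to classes with \<open>\<pi>E\<close>.\<close>
  define g where "g x = (SOME y. y \<in> SE \<and> \<delta> y = q x)" for x
  have g: "g x \<in> SE" "\<delta> (g x) = q x" if "x \<in> S" for x
  proof -
    have "\<exists>y. y \<in> SE \<and> \<delta> y = q x" using qS[OF that] by auto
    from someI_ex[OF this] show "g x \<in> SE" "\<delta> (g x) = q x" unfolding g_def by auto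
  qed
  have \<pi>E: "\<pi>E y = \<pi>E z" if "y \<in> SE" "z \<in> SE" "\<delta> y = \<delta> z" for y z
    using that \<delta>(2)[of "y - z"] presents_eq_iff[OF E, of y z] subspace_diff[OF SE(1) that(1,2)]
    by (auto simp: linear_diff[OF \<delta>(1)])
  define H where "H x = (\<pi>A (f x), \<pi>E (g x))" for x
  define \<rho> where "\<rho> X = (SOME x. x \<in> S \<and> \<pi> x = X)" for X
  have \<rho>: "\<rho> X \<in> S" "\<pi> (\<rho> X) = X" if "X \<in> carrier M" for X
  proof -
    have "\<exists>x. x \<in> S \<and> \<pi> x = X" using that unfolding SM(4)[symmetric] by auto
    from someI_ex[OF this] show "\<rho> X \<in> S" "\<pi> (\<rho> X) = X" unfolding \<rho>_def by auto
  qed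
  \<comment> \<open>One equivalence gives both that \<open>H\<close> descends to classes and that
    the descended map is injective.\<close>
  have H_eq: "H x = H y \<longleftrightarrow> \<pi> x = \<pi> y" if x: "x \<in> S" and y: "y \<in> S" for x y
  proof -
    have d: "x - y \<in> S" by (rule subspace_diff[OF SM(1) x y])
    have "g x - g y \<in> SE" by (rule subspace_diff[OF SE(1) g(1)[OF x] g(1)[OF y]])
    moreover have "q (x - y) = \<delta> (g x - g y)"
      using g(2) x y by (simp add: linear_diff[OF \<delta>(1)] linear_diff[OF q])
    ultimately have "x - y \<in> N \<longleftrightarrow> f (x - y) \<in> NA \<and> g x - g y \<in> NE"
      using inj[OF d] by blast
    then show ?thesis
      using presents_eq_iff[OF M x y] presents_eq_iff[OF A fS[OF x] fS[OF y]]
        presents_eq_iff[OF E, of "g x" "g y"] g(1)[OF x] g(1)[OF y]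
      by (auto simp: H_def linear_diff[OF f])
  qed
  have H_\<pi>: "H (\<rho> (\<pi> x)) = H x" if "x \<in> S" for x
    using \<rho>[of "\<pi> x"] H_eq that SM(4) by auto
  have H_add: "H (x + y) = H x \<oplus>\<^bsub>dsum_module A E\<^esub> H y" if x: "x \<in> S" and y: "y \<in> S" for x y
  proof -
    have "\<pi>E (g (x + y)) = \<pi>E (g x + g y)"
      using g subspace_add[OF SM(1) x y] subspace_add[OF SE(1)] x y
      by (intro \<pi>E) (auto simp: linear_add[OF \<delta>(1)] linear_add[OF q])
    then show ?thesis
      using SA(5)[OF fS[OF x] fS[OF y]] SE(5)[of "g x" "g y"] g(1)[OF x] g(1)[OF y]
      by (auto simp: H_def dsum_module_def linear_add[OF f])
  qed
  have H_scale: "H (a *\<^sub>R x) = a \<odot>\<^bsub>dsum_module A E\<^esub> H x" if x: "x \<in> S" for a x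
  proof -
    have "\<pi>E (g (a *\<^sub>R x)) = \<pi>E (a *\<^sub>R g x)"
      using g subspace_scale[OF SM(1) x] subspace_scale[OF SE(1)] x
      by (intro \<pi>E) (auto simp: linear_scale[OF \<delta>(1)] linear_scale[OF q])
    then show ?thesis
      using SA(6)[OF fS[OF x]] SE(6)[of "g x"] g(1)[OF x]
      by (auto simp: H_def dsum_module_def linear_scale[OF f])
  qed
  have H_carrier: "H x \<in> carrier (dsum_module A E)" if "x \<in> S" for x
    using SA(4) SE(4) fS[OF that] g(1)[OF that] by (auto simp: H_def dsum_module_def)
  have "(\<lambda>X. H (\<rho> X)) \<in> lin_maps M (dsum_module A E)"
    unfolding lin_maps_def
  proof (intro CollectI conjI funcsetI ballI allI)
    fix X Y assume X: "X \<in> carrier M" and Y: "Y \<in> carrier M"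
    have "X \<oplus>\<^bsub>M\<^esub> Y = \<pi> (\<rho> X + \<rho> Y)" using SM(5) \<rho> X Y by simp
    then show "H (\<rho> (X \<oplus>\<^bsub>M\<^esub> Y)) = H (\<rho> X) \<oplus>\<^bsub>dsum_module A E\<^esub> H (\<rho> Y)"
      using H_\<pi> H_add subspace_add[OF SM(1)] \<rho> X Y by simp
  next
    fix a X assume X: "X \<in> carrier M"
    have "a \<odot>\<^bsub>M\<^esub> X = \<pi> (a *\<^sub>R \<rho> X)" using SM(6) \<rho> X by simp
    then show "H (\<rho> (a \<odot>\<^bsub>M\<^esub> X)) = a \<odot>\<^bsub>dsum_module A E\<^esub> H (\<rho> X)"
      using H_\<pi> H_scale subspace_scale[OF SM(1)] \<rho> X by simp
  qed (use \<rho> H_carrier in auto)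
  moreover have "bij_betw (\<lambda>X. H (\<rho> X)) (carrier M) (carrier (dsum_module A E))"
  proof (rule bij_betw_imageI)
    show "inj_on (\<lambda>X. H (\<rho> X)) (carrier M)"
      using H_eq \<rho> by (intro inj_onI) metis
    show "(\<lambda>X. H (\<rho> X)) ` carrier M = carrier (dsum_module A E)"
    proof (intro equalityI subsetI)
      fix w assume "w \<in> carrier (dsum_module A E)"
      then obtain a e where w: "a \<in> SA" "e \<in> SE" "w = (\<pi>A a, \<pi>E e)"
        unfolding dsum_module_def using SA(4) SE(4) by (auto simp: image_iff set_eq_iff) metis
      from surj[OF w(1,2)] obtain x y where
        xy: "x \<in> S" "y \<in> SE" "a - f x \<in> NA" "q x = \<delta> y" "e - y \<in> NE" by auto
      have "\<pi>A a = \<pi>A (f x)" using presents_eq_iff[OF A] w fS xy by blast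
      moreover have "\<pi>E e = \<pi>E y" using presents_eq_iff[OF E] w xy by blast
      moreover have "\<pi>E y = \<pi>E (g x)" using g xy by (intro \<pi>E) auto
      ultimately have "w = H x" by (simp add: w H_def)
      then show "w \<in> (\<lambda>X. H (\<rho> X)) ` carrier M" using H_\<pi>[OF xy(1)] SM(4) xy(1) by force
    qed (use \<rho> H_carrier in auto)
  qed
  ultimately show ?thesis unfolding lin_iso_def by blast
qed

text \<open>The map \<open>g\<close> is the projection onto a complement of \<open>N \<inter> Z\<close> in \<open>Z\<close> along \<open>N\<close>.\<close>

lemma ex_linear_retraction_mod:
  fixes Z N :: "'v::real_vector set"
  assumes Z: "subspace Z" and N: "subspace N"
  obtains g where "linear g" "range g \<subseteq> Z" "\<And>x. x \<in> N \<Longrightarrow> g x = 0"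
    "\<And>x z. x - z \<in> N \<Longrightarrow> z \<in> Z \<Longrightarrow> x - g x \<in> N"
proof -
  have proj: "\<exists>E. linear E \<and> range E \<subseteq> S \<and> (\<forall>x\<in>S. E x = x)" if "subspace S" for S :: "'v set"
    using linear_exists_left_inverse_on[of "\<lambda>x::'v. x", OF linear_ident that] by auto
  obtain Q where Q: "linear Q" "range Q \<subseteq> Z \<inter> N" "\<And>x. x \<in> Z \<inter> N \<Longrightarrow> Q x = x"
    using proj[OF subspace_inter[OF Z N]] by blast
  obtain E where E: "linear E" "range E \<subseteq> N" "\<And>x. x \<in> N \<Longrightarrow> E x = x"
    using proj[OF N] by blast
  \<comment> \<open>\<open>Q\<close> projects onto \<open>Z \<inter> N\<close>, so its kernel inside
    \<open>Z\<close> is a complement of \<open>Z \<inter> N\<close> in \<open>Z\<close>.\<close>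
  define C where "C = Z \<inter> Q -` {0}"
  have C: "subspace C"
    unfolding C_def by (intro subspace_inter Z linear_subspace_vimage Q(1) subspace_single_0)
  have lin: "linear (\<lambda>x. x - E x)"
    by (rule linear_compose_sub[OF linear_ident E(1)])
  \<comment> \<open>\<open>C\<close> meets \<open>N\<close> only in zero, hence it still embeds
    after the component \<open>E x\<close> in \<open>N\<close> is removed. \<open>G\<close> undoes
    this, and composing it with \<open>x - E x\<close> gives a map that vanishes on
    \<open>N\<close>.\<close>
  have "inj_on (\<lambda>x. x - E x) C"
  proof (rule inj_onI)
    fix x y assume xy: "x \<in> C" "y \<in> C" "x - E x = y - E y"
    have "x - y = E (x - y)" using xy(3) by (simp add: linear_diff[OF E(1)] algebra_simps)
    then have "x - y \<in> N" using E(2) by (metis rangeI subsetD)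
    moreover have "x - y \<in> C" by (rule subspace_diff[OF C xy(1,2)])
    ultimately show "x = y" using Q(3)[of "x - y"] by (simp add: C_def)
  qed
  then obtain G where G: "range G \<subseteq> C" "linear G" "\<And>x. x \<in> C \<Longrightarrow> G (x - E x) = x"
    using linear_exists_left_inverse_on[OF lin C] by blast
  show ?thesis
  proof (rule that[of "\<lambda>x. G (x - E x)"])
    show "linear (\<lambda>x. G (x - E x))"
      using linear_compose[OF lin G(2)] by (simp add: o_def)
    show "range (\<lambda>x. G (x - E x)) \<subseteq> Z" using G(1) by (auto simp: C_def)
    show *: "G (x - E x) = 0" if "x \<in> N" for x using E(3)[OF that] linear_0[OF G(2)] by simp
    show "x - G (x - E x) \<in> N" if "x - z \<in> N" "z \<in> Z" for x z
    proof -
      have Qz: "Q z \<in> Z \<inter> N" using Q(2) by auto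
      then have c: "z - Q z \<in> C"
        using Q(3)[OF Qz] that(2) subspace_diff[OF Z] by (simp add: C_def linear_diff[OF Q(1)])
      have n: "(x - z) + Q z \<in> N" using that(1) Qz subspace_add[OF N] by blast
      have "x = ((x - z) + Q z) + (z - Q z)" by simp
      then have "G (x - E x) = G ((x - z + Q z) - E (x - z + Q z)) + G ((z - Q z) - E (z - Q z))"
        by (metis linear_add[OF G(2)] linear_add[OF lin])
      also have "\<dots> = z - Q z" using *[OF n] G(3)[OF c] by simp
      finally have eq: "x - G (x - E x) = (x - z) + Q z" by simp
      show ?thesis using n by (simp only: eq)
    qed
  qed
qed

section \<open>A complex with a subcomplex: relative cohomology and the splitting\<close>

locale cochain_pair =
  fixes P R :: "int \<Rightarrow> 'v::real_vector set" and d :: "'v \<Rightarrow> 'v"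
  assumes sub_P: "\<And>p. subspace (P p)" and sub_R: "\<And>p. subspace (R p)"
    and R_P: "\<And>p. R p \<subseteq> P p" and lin: "linear d"
    and d_P: "\<And>p x. x \<in> P p \<Longrightarrow> d x \<in> P (p + 1)"
    and d_R: "\<And>p x. x \<in> R p \<Longrightarrow> d x \<in> R (p + 1)"
    and d_d: "\<And>p x. x \<in> P p \<Longrightarrow> d (d x) = 0"
begin

text \<open>The constants from here to \<open>secs\<close> copy those of the statement for an
  abstract pair; the interpretation in the final proof identifies them by unfolding.\<close>

definition CP where "CP p = vspace (P p)"
definition CR where "CR p = vspace (R p)"
definition CQ where "CQ p = quot_module (CP p) (R p)"
definition dQ where "dQ p = induced (CP (p + 1)) (R (p + 1)) d"
definition HP where "HP = cohomology CP (\<lambda>_. d)"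
definition HR where "HR = cohomology CR (\<lambda>_. d)"
definition HQ where "HQ = cohomology CQ dQ"
definition nat_map where
  "nat_map p = induced (CQ p) (coboundaries CQ dQ p) (\<lambda>c. R p +>\<^bsub>CP p\<^esub> c)"
definition conn where
  "conn p X = induced (CR (p + 1)) (coboundaries CR (\<lambda>_. d) (p + 1)) d (\<Union>X)"
definition ker_conn where "ker_conn p = a_kernel (HQ p) (HR (p + 1)) (conn p)"
definition secs where
  "secs p = {\<sigma> \<in> lin_maps (HQ p\<lparr>carrier := ker_conn p\<rparr>) (HP p).
     \<forall>X\<in>ker_conn p. nat_map p (\<sigma> X) = X}"

text \<open>Spaces of representatives: cocycles \<open>Z\<close>, coboundaries \<open>B\<close> and class maps \<open>c\<close> for \<open>P\<close>, \<open>R\<close> and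
  the quotient \<open>Q = P / R\<close>, and \<open>K\<close> for the kernel of the connecting homomorphism.\<close>

definition ZP where "ZP p = {x \<in> P p. d x = 0}"
definition BP where "BP p = d ` P (p - 1)"
definition ZR where "ZR p = {x \<in> R p. d x = 0}"
definition BR where "BR p = d ` R (p - 1)"
definition ZQ where "ZQ p = {x \<in> P p. d x \<in> R (p + 1)}"
definition BQ where "BQ p = {a + b |a b. a \<in> R p \<and> b \<in> BP p}"
definition K where "K p = {x \<in> ZQ p. d x \<in> BR (p + 1)}"

definition cP where "cP p x = BP p +>\<^bsub>CP p\<^esub> x"
definition cR where "cR p x = BR p +>\<^bsub>CR p\<^esub> x"
definition cosR where "cosR p x = R p +>\<^bsub>CP p\<^esub> x"
definition cQ where "cQ p x = cosR p ` BQ p +>\<^bsub>CQ p\<^esub> cosR p x"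

lemma d_P': "x \<in> P (p - 1) \<Longrightarrow> d x \<in> P p" using d_P[of x "p - 1"] by simp
lemma d_R': "x \<in> R (p - 1) \<Longrightarrow> d x \<in> R p" using d_R[of x "p - 1"] by simp

lemma pCP: "presents (CP p) (P p) {0} (\<lambda>x. x)"
  unfolding CP_def by (rule presents_vspace[OF sub_P])

lemma pCR: "presents (CR p) (R p) {0} (\<lambda>x. x)"
  unfolding CR_def by (rule presents_vspace[OF sub_R])

lemma zero_R: "0 \<in> R p" by (rule subspace_0[OF sub_R])

lemma pCQ: "presents (CQ p) (P p) (R p) (cosR p)"
  using presents_quot[OF pCP sub_R _ R_P, of p] zero_R
  unfolding CQ_def cosR_def by simp

lemma dQ_cosR: "x \<in> P p \<Longrightarrow> dQ p (cosR p x) = cosR (p + 1) (d x)"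
  using induced_presented_coset[OF pCP[of p] sub_R R_P pCP[of "p + 1"] sub_R _ R_P,
      where x = x and h = d and \<delta> = d]
  by (simp add: dQ_def cosR_def zero_R d_P d_R linear_diff[OF lin])

lemma d_zero: "d 0 = 0" by (rule linear_0[OF lin])

lemma HP_facts:
  shows sub_ZP: "subspace (ZP p)" and sub_BP: "subspace (BP p)" and BP_ZP: "BP p \<subseteq> ZP p"
    and pHP: "presents (HP p) (ZP p) (BP p) (cP p)"
proof -
  note * = presents_cohomology[of CP p, OF pCP pCP pCP lin, of "\<lambda>_. d"]
  have B: "{a + b |a b. a \<in> {0} \<and> b \<in> d ` P (p - 1)} = BP p" by (auto simp: BP_def)
  have Z: "{x \<in> P p. d x \<in> {0}} = ZP p" by (auto simp: ZP_def)
  show "subspace (ZP p)" "subspace (BP p)" "BP p \<subseteq> ZP p" "presents (HP p) (ZP p) (BP p) (cP p)"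
    using *(2,3,5,7)[unfolded B Z] d_P d_P' d_d d_zero
    by (auto simp: HP_def cP_def[abs_def])
qed

lemma HR_facts:
  shows sub_ZR: "subspace (ZR p)" and sub_BR: "subspace (BR p)" and BR_ZR: "BR p \<subseteq> ZR p"
    and cob_R: "coboundaries CR (\<lambda>_. d) p = BR p"
    and pHR: "presents (HR p) (ZR p) (BR p) (cR p)"
proof -
  note * = presents_cohomology[of CR p, OF pCR pCR pCR lin, of "\<lambda>_. d"]
  have B: "{a + b |a b. a \<in> {0} \<and> b \<in> d ` R (p - 1)} = BR p" by (auto simp: BR_def)
  have Z: "{x \<in> R p. d x \<in> {0}} = ZR p" by (auto simp: ZR_def)
  have dd: "d (d x) = 0" if "x \<in> R q" for x q using d_d R_P that by blast
  show "subspace (ZR p)" "subspace (BR p)" "BR p \<subseteq> ZR p"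
    "coboundaries CR (\<lambda>_. d) p = BR p" "presents (HR p) (ZR p) (BR p) (cR p)"
    using *(1,2,3,5,7)[unfolded B Z] d_R d_R' dd d_zero
    by (auto simp: HR_def cR_def[abs_def])
qed

lemma HQ_facts:
  shows sub_ZQ: "subspace (ZQ p)" and sub_BQ: "subspace (BQ p)" and R_BQ: "R p \<subseteq> BQ p"
    and BQ_ZQ: "BQ p \<subseteq> ZQ p"
    and cob_Q: "coboundaries CQ dQ p = cosR p ` BQ p"
    and pHQ: "presents (HQ p) (ZQ p) (BQ p) (cQ p)"
proof -
  note * = presents_cohomology[of CQ p, OF pCQ pCQ pCQ lin, of dQ]
  have B: "{a + b |a b. a \<in> R p \<and> b \<in> d ` P (p - 1)} = BQ p" by (auto simp: BQ_def BP_def)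
  have Z: "{x \<in> P p. d x \<in> R (p + 1)} = ZQ p" by (auto simp: ZQ_def)
  have dQ': "dQ (p - 1) (cosR (p - 1) x) = cosR p (d x)" if "x \<in> P (p - 1)" for x
    using dQ_cosR[OF that] by simp
  show "subspace (ZQ p)" "subspace (BQ p)" "R p \<subseteq> BQ p" "BQ p \<subseteq> ZQ p"
    "coboundaries CQ dQ p = cosR p ` BQ p" "presents (HQ p) (ZQ p) (BQ p) (cQ p)"
    using *(2,3,4,5,1,7)[unfolded B Z] d_P d_P' d_R d_d zero_R dQ_cosR dQ'
    by (auto simp: HQ_def cQ_def[abs_def])
qed

lemma BP_BQ: "BP p \<subseteq> BQ p" using zero_R by (force simp: BQ_def)

lemma nat_map_cP: "x \<in> ZP p \<Longrightarrow> nat_map p (cP p x) = cQ p x"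
  using induced_presented_coset[OF pCP[of p] sub_BP _ pCQ[of p] sub_BQ R_BQ,
      where x = x and \<delta> = "\<lambda>x. x" and h = "cosR p"]
    BP_ZP[of p] BQ_ZQ[of p] BP_BQ[of p]
  by (auto simp: nat_map_def cP_def cQ_def cob_Q ZP_def ZQ_def cosR_def[abs_def] subset_eq)

text \<open>The representatives of a relative class form \<open>x + R + d P\<close>. Changing
  \<open>x\<close> by \<open>a + d w\<close> with \<open>a\<close> in \<open>R\<close> changes
  \<open>d x\<close> by \<open>d a\<close> only, a coboundary of \<open>R\<close>, so all of them
  give one class.\<close>

lemma conn_cQ:
  assumes x: "x \<in> ZQ p"
  shows "conn p (cQ p x) = cR (p + 1) (d x)"
proof -
  have xP: "x \<in> P p" and BQ_P: "BQ p \<subseteq> P p" using x BQ_ZQ[of p] by (auto simp: ZQ_def)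
  have cosR: "cosR p y = {z. z - y \<in> R p}" if "y \<in> P p" for y
    using presents_coset[OF pCP sub_R R_P that] by (simp add: cosR_def)
  have "\<Union> (cQ p x) = (\<Union>y\<in>{y. y - x \<in> BQ p}. cosR p y)"
    unfolding cQ_def presents_coset[OF pCQ sub_BQ BQ_P xP] ..
  also have "\<dots> = {z. z - x \<in> BQ p}"
  proof (intro equalityI subsetI)
    fix z assume "z \<in> (\<Union>y\<in>{y. y - x \<in> BQ p}. cosR p y)"
    then obtain y where y: "y - x \<in> BQ p" "z \<in> cosR p y" by auto
    have "y \<in> P p" using subspace_add[OF sub_P, of "y - x" p x] y(1) BQ_P xP by auto
    then have "z - y \<in> BQ p" using y(2) cosR R_BQ by auto
    then have "(z - y) + (y - x) \<in> BQ p" using y(1) subspace_add[OF sub_BQ] by blast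
    then show "z \<in> {z. z - x \<in> BQ p}" by simp
  next
    fix z assume "z \<in> {z. z - x \<in> BQ p}"
    moreover then have "z \<in> P p" using subspace_add[OF sub_P, of "z - x" p x] BQ_P xP by auto
    ultimately show "z \<in> (\<Union>y\<in>{y. y - x \<in> BQ p}. cosR p y)"
      using cosR[of z] zero_R by auto
  qed
  finally have U: "\<Union> (cQ p x) = {z. z - x \<in> BQ p}" .
  have "BR (p + 1) +>\<^bsub>CR (p + 1)\<^esub> d z = cR (p + 1) (d x)" if z: "z - x \<in> BQ p" for z
  proof -
    obtain a w where w: "z - x = a + d w" "a \<in> R p" "w \<in> P (p - 1)"
      using z by (auto simp: BQ_def BP_def)
    have e: "d z - d x = d a"
      using arg_cong[OF w(1), of d] d_d[OF w(3)] by (simp add: linear_diff[OF lin] linear_add[OF lin])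
    have "d a \<in> BR (p + 1)" using w(2) by (auto simp: BR_def)
    moreover have "d x \<in> R (p + 1)" using x by (simp add: ZQ_def)
    moreover have "d z \<in> R (p + 1)"
    proof -
      have "d z = d a + d x" using e by (simp add: algebra_simps)
      then show ?thesis using subspace_add[OF sub_R d_R[OF w(2)]] x by (simp add: ZQ_def)
    qed
    moreover have "BR (p + 1) \<subseteq> R (p + 1)" using BR_ZR by (auto simp: ZR_def)
    ultimately show ?thesis
      using presents_coset_eq_iff[OF pCR[of "p + 1"] sub_BR[of "p + 1"], of "d z" "d x"] e
        subspace_0[OF sub_BR] by (simp add: cR_def)
  qed
  moreover have "{z. z - x \<in> BQ p} \<noteq> {}" using subspace_0[OF sub_BQ] by (auto intro: exI[of _ x])
  ultimately show ?thesis
    unfolding conn_def U induced_def cob_R by (intro SUP_eq_const) blast+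
qed

lemma ker_conn_eq: "ker_conn p = cQ p ` K p"
proof -
  have "conn p (cQ p x) = \<zero>\<^bsub>HR (p + 1)\<^esub> \<longleftrightarrow> d x \<in> BR (p + 1)" if "x \<in> ZQ p" for x
  proof -
    have "d x \<in> ZR (p + 1)" using that d_d by (auto simp: ZQ_def ZR_def)
    then show ?thesis using presentsD(7)[OF pHR] conn_cQ[OF that] by simp
  qed
  then show ?thesis
    unfolding ker_conn_def a_kernel_def' presentsD(4)[OF pHQ, symmetric] K_def by blast
qed

text \<open>\<open>K_split\<close> is exactness at the relative cohomology: if
  \<open>d x = d a\<close> with \<open>a\<close> in \<open>R\<close>, then \<open>x - a\<close> is a
  cocycle of \<open>P\<close> representing the same relative class.\<close>

lemma K_facts:
  shows sub_K: "subspace (K p)" and BQ_K: "BQ p \<subseteq> K p" and K_ZQ: "K p \<subseteq> ZQ p" and ZP_K: "ZP p \<subseteq> K p"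
    and K_split: "x \<in> K p \<Longrightarrow> \<exists>z\<in>ZP p. x - z \<in> BQ p"
proof -
  have "K p = ZQ p \<inter> d -` BR (p + 1)" by (auto simp: K_def)
  then show "subspace (K p)"
    using subspace_inter[OF sub_ZQ linear_subspace_vimage[OF lin sub_BR]] by simp
  have "d x \<in> BR (p + 1)" if "x \<in> BQ p" for x
    using that d_d by (auto simp: BQ_def BP_def BR_def linear_add[OF lin])
  then show "BQ p \<subseteq> K p" using BQ_ZQ by (auto simp: K_def)
  show "K p \<subseteq> ZQ p" by (auto simp: K_def)
  show "ZP p \<subseteq> K p"
    using zero_R subspace_0[OF sub_BR] by (auto simp: ZP_def K_def ZQ_def)
  show "\<exists>z\<in>ZP p. x - z \<in> BQ p" if xK: "x \<in> K p"
  proof -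
    obtain a where a: "a \<in> R p" "d x = d a" using xK by (auto simp: K_def BR_def)
    then have "x - a \<in> ZP p"
      using xK R_P subspace_diff[OF sub_P, of x p a]
      by (auto simp: ZP_def K_def ZQ_def linear_diff[OF lin])
    then show ?thesis using a(1) R_BQ by (intro bexI[of _ "x - a"]) auto
  qed
qed

lemma pK: "presents (HQ p\<lparr>carrier := ker_conn p\<rparr>) (K p) (BQ p) (cQ p)"
  unfolding ker_conn_eq by (rule presents_sub[OF pHQ sub_K BQ_K K_ZQ])

text \<open>The linear map \<open>g\<close> into the cocycles of \<open>P\<close> kills
  \<open>BQ\<close>, so it descends to relative classes. An element of \<open>K\<close> is congruent
  modulo \<open>BQ\<close> to some cocycle, hence also to its image under \<open>g\<close>, which
  makes the descended map a section.\<close>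

lemma secs_nonempty: "secs p \<noteq> {}"
proof -
  obtain g where g: "linear g" "range g \<subseteq> ZP p" "\<And>x. x \<in> BQ p \<Longrightarrow> g x = 0"
    "\<And>x z. x - z \<in> BQ p \<Longrightarrow> z \<in> ZP p \<Longrightarrow> x - g x \<in> BQ p"
    using ex_linear_retraction_mod[OF sub_ZP sub_BQ] by blast
  define \<rho> where "\<rho> X = (SOME x. x \<in> K p \<and> cQ p x = X)" for X
  have \<rho>: "\<rho> X \<in> K p" "cQ p (\<rho> X) = X" if "X \<in> ker_conn p" for X
  proof -
    have "\<exists>x. x \<in> K p \<and> cQ p x = X" using that unfolding ker_conn_eq by auto
    from someI_ex[OF this] show "\<rho> X \<in> K p" "cQ p (\<rho> X) = X" unfolding \<rho>_def by auto
  qed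
  have gZ: "g x \<in> ZP p" for x using g(2) by auto
  have gK: "g x \<in> K p" for x using gZ ZP_K by blast
  have \<rho>g: "g (\<rho> (cQ p x)) = g x" if "x \<in> K p" for x
  proof -
    have X: "cQ p x \<in> ker_conn p" using that by (simp add: ker_conn_eq)
    then have "\<rho> (cQ p x) - x \<in> BQ p"
      using presents_eq_iff[OF pK \<rho>(1)[OF X] that] \<rho>(2)[OF X] by simp
    from g(3)[OF this] show ?thesis by (simp add: linear_diff[OF g(1)])
  qed
  define \<sigma> where "\<sigma> X = cP p (g (\<rho> X))" for X
  have "\<sigma> \<in> lin_maps (HQ p\<lparr>carrier := ker_conn p\<rparr>) (HP p)"
    unfolding lin_maps_def
  proof (intro CollectI conjI funcsetI ballI allI)
    fix X assume "X \<in> carrier (HQ p\<lparr>carrier := ker_conn p\<rparr>)"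
    show "\<sigma> X \<in> carrier (HP p)"
      using gZ unfolding \<sigma>_def presentsD(4)[OF pHP, symmetric] by auto
  next
    fix X Y
    assume "X \<in> carrier (HQ p\<lparr>carrier := ker_conn p\<rparr>)" "Y \<in> carrier (HQ p\<lparr>carrier := ker_conn p\<rparr>)"
    then have XY: "X \<in> ker_conn p" "Y \<in> ker_conn p" by simp_all
    have "X \<oplus>\<^bsub>HQ p\<lparr>carrier := ker_conn p\<rparr>\<^esub> Y = cQ p (\<rho> X + \<rho> Y)"
      using presentsD(5)[OF pK] \<rho> XY by simp
    then show "\<sigma> (X \<oplus>\<^bsub>HQ p\<lparr>carrier := ker_conn p\<rparr>\<^esub> Y) = \<sigma> X \<oplus>\<^bsub>HP p\<^esub> \<sigma> Y"
      using \<rho>g subspace_add[OF sub_K] \<rho> XY presentsD(5)[OF pHP gZ gZ]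
      by (simp add: \<sigma>_def linear_add[OF g(1)])
  next
    fix a X assume "X \<in> carrier (HQ p\<lparr>carrier := ker_conn p\<rparr>)"
    then have X: "X \<in> ker_conn p" by simp
    have "a \<odot>\<^bsub>HQ p\<lparr>carrier := ker_conn p\<rparr>\<^esub> X = cQ p (a *\<^sub>R \<rho> X)"
      using presentsD(6)[OF pK] \<rho> X by simp
    then show "\<sigma> (a \<odot>\<^bsub>HQ p\<lparr>carrier := ker_conn p\<rparr>\<^esub> X) = a \<odot>\<^bsub>HP p\<^esub> \<sigma> X"
      using \<rho>g subspace_scale[OF sub_K] \<rho> X presentsD(6)[OF pHP gZ]
      by (simp add: \<sigma>_def linear_scale[OF g(1)])
  qed
  moreover have "nat_map p (\<sigma> X) = X" if X: "X \<in> ker_conn p" for X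
  proof -
    obtain z where "z \<in> ZP p" "\<rho> X - z \<in> BQ p" using K_split \<rho>(1)[OF X] by blast
    then have "\<rho> X - g (\<rho> X) \<in> BQ p" using g(4) by blast
    then have "cQ p (\<rho> X) = cQ p (g (\<rho> X))"
      using presents_eq_iff[OF pK \<rho>(1)[OF X] gK] by simp
    then show ?thesis using nat_map_cP[OF gZ] \<rho>(2)[OF X] by (simp add: \<sigma>_def)
  qed
  ultimately show ?thesis unfolding secs_def by blast
qed

text \<open>A cocycle \<open>x\<close> of \<open>R\<close> goes to its class modulo
  \<open>T\<close>, the preimage of the image of \<sigma>, and to the class modulo
  \<open>K (p - 1)\<close> of some \<open>y\<close> with \<open>d y = q x\<close>, where
  \<open>q\<close> projects onto \<open>ZR p \<inter> BP p\<close>.\<close>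

lemma HR_decomposition:
  assumes \<sigma>: "\<sigma> \<in> secs p"
  shows "HR p \<cong>\<^sub>\<real> dsum_module (quot_module (HP p) (\<sigma> ` ker_conn p))
    (quot_module (HQ (p - 1)) (ker_conn (p - 1)))"
proof -
  note HP = presentsD[OF pHP[of p]] and pKp = presentsD[OF pK[of p]]
  have \<sigma>_carrier: "\<sigma> X \<in> carrier (HP p)" if "X \<in> ker_conn p" for X
    using \<sigma> that by (auto simp: secs_def lin_maps_def)
  have \<sigma>_add: "\<sigma> (X \<oplus>\<^bsub>HQ p\<^esub> Y) = \<sigma> X \<oplus>\<^bsub>HP p\<^esub> \<sigma> Y" if "X \<in> ker_conn p" "Y \<in> ker_conn p" for X Y
    using \<sigma> that by (auto simp: secs_def lin_maps_def)
  have \<sigma>_scale: "\<sigma> (a \<odot>\<^bsub>HQ p\<^esub> X) = a \<odot>\<^bsub>HP p\<^esub> \<sigma> X" if "X \<in> ker_conn p" for a X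
    using \<sigma> that by (auto simp: secs_def lin_maps_def)
  have \<sigma>_nat: "nat_map p (\<sigma> X) = X" if "X \<in> ker_conn p" for X
    using \<sigma> that by (auto simp: secs_def)
  have lift: "\<exists>z\<in>ZP p. \<sigma> X = cP p z" if "X \<in> ker_conn p" for X
    using \<sigma>_carrier[OF that] unfolding HP(4)[symmetric] by auto
  have cQ_ker: "cQ p x \<in> ker_conn p" if "x \<in> K p" for x
    using that by (simp add: ker_conn_eq)
  have zero: "\<sigma> (cQ p 0) = cP p 0"
  proof -
    have k0: "cQ p 0 \<in> ker_conn p" by (rule cQ_ker[OF subspace_0[OF sub_K]])
    obtain z where z: "z \<in> ZP p" "\<sigma> (cQ p 0) = cP p z" using lift[OF k0] by blast
    \<comment> \<open>\<open>lin_maps\<close> provides additivity and homogeneity on the carrier;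
      the scalar 0 then yields preservation of zero.\<close>
    have "cQ p 0 = 0 \<odot>\<^bsub>HQ p\<^esub> cQ p 0"
      using presentsD(6)[OF pHQ subspace_0[OF sub_ZQ], of p 0] by simp
    then have "\<sigma> (cQ p 0) = 0 \<odot>\<^bsub>HP p\<^esub> cP p z" using \<sigma>_scale[OF k0, of 0] z(2) by simp
    then show ?thesis using HP(6)[OF z(1), of 0] by simp
  qed
  define T where "T = {z \<in> ZP p. cP p z \<in> \<sigma> ` ker_conn p}"
  have T_img: "\<sigma> ` ker_conn p = cP p ` T"
  proof
    show "\<sigma> ` ker_conn p \<subseteq> cP p ` T"
    proof
      fix Y assume Y: "Y \<in> \<sigma> ` ker_conn p"
      then obtain z where "z \<in> ZP p" "Y = cP p z" using lift by blast
      with Y show "Y \<in> cP p ` T" by (simp add: T_def)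
    qed
  qed (auto simp: T_def)
  have T_ZP: "T \<subseteq> ZP p" by (auto simp: T_def)
  have BP_T: "BP p \<subseteq> T"
  proof
    fix z assume z: "z \<in> BP p"
    then have zZ: "z \<in> ZP p" using BP_ZP by blast
    have "cP p z = cP p 0"
      using z presents_eq_iff[OF pHP zZ subspace_0[OF sub_ZP]] by simp
    then show "z \<in> T" using zero zZ cQ_ker[OF subspace_0[OF sub_K]] by (auto simp: T_def image_iff)
  qed
  have T_E: "\<exists>k\<in>K p. cP p z = \<sigma> (cQ p k)" if "z \<in> T" for z
    using that by (auto simp: T_def ker_conn_eq)
  have sub_T: "subspace T"
  proof (rule subspaceI)
    show "0 \<in> T" using BP_T subspace_0[OF sub_BP] by blast
  next
    fix x y assume xy: "x \<in> T" "y \<in> T"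
    obtain k where k: "k \<in> K p" "cP p x = \<sigma> (cQ p k)" using T_E[OF xy(1)] by blast
    obtain m where m: "m \<in> K p" "cP p y = \<sigma> (cQ p m)" using T_E[OF xy(2)] by blast
    have Z: "x \<in> ZP p" "y \<in> ZP p" using xy T_ZP by auto
    have "cP p (x + y) = \<sigma> (cQ p (k + m))"
      using HP(5)[OF Z] k m \<sigma>_add[OF cQ_ker[OF k(1)] cQ_ker[OF m(1)]] pKp(5)[OF k(1) m(1)] by simp
    then show "x + y \<in> T"
      using subspace_add[OF sub_ZP Z] cQ_ker[OF subspace_add[OF sub_K k(1) m(1)]] by (simp add: T_def)
  next
    fix a x assume x: "x \<in> T"
    obtain k where k: "k \<in> K p" "cP p x = \<sigma> (cQ p k)" using T_E[OF x] by blast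
    have Z: "x \<in> ZP p" using x T_ZP by auto
    have "cP p (a *\<^sub>R x) = \<sigma> (cQ p (a *\<^sub>R k))"
      using HP(6)[OF Z] k \<sigma>_scale[OF cQ_ker[OF k(1)]] pKp(6)[OF k(1)] by simp
    then show "a *\<^sub>R x \<in> T"
      using subspace_scale[OF sub_ZP Z] cQ_ker[OF subspace_scale[OF sub_K k(1)]] by (simp add: T_def)
  qed
  have BR_BP: "BR p \<subseteq> BP p" using R_P by (auto simp: BR_def BP_def)
  have ZR_ZP: "ZR p \<subseteq> ZP p" using R_P by (auto simp: ZR_def ZP_def)
  \<comment> \<open>Any projection will do. Its choice decides how a class of \<open>R\<close> is
    split, so the resulting isomorphism is not canonical.\<close>
  obtain q where q: "linear q" "range q \<subseteq> ZR p \<inter> BP p" "\<And>x. x \<in> ZR p \<inter> BP p \<Longrightarrow> q x = x"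
    using linear_exists_left_inverse_on[of "\<lambda>x::'v. x", OF linear_ident
        subspace_inter[OF sub_ZR[of p] sub_BP[of p]]]
    by (auto simp: inj_on_def)
  \<comment> \<open>A potential primitive \<open>y\<close> of a cocycle of \<open>R\<close> is
    automatically a relative cocycle, because \<open>d y\<close> lies in \<open>R\<close>. With
    \<open>d_ZQ\<close> this says that \<open>d\<close> maps \<open>ZQ (p - 1)\<close> onto the
    range of \<open>q\<close>.\<close>
  have BP_E: "\<exists>y\<in>ZQ (p - 1). x = d y" if "x \<in> ZR p \<inter> BP p" for x
    using that by (auto simp: BP_def ZQ_def ZR_def)
  have d_ZQ: "d y \<in> ZR p \<inter> BP p" if "y \<in> ZQ (p - 1)" for y
    using that d_d by (auto simp: BP_def ZQ_def ZR_def)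
  show ?thesis
    unfolding T_img
    unfolding ker_conn_eq[of "p - 1"]
  proof (rule presents_dsum_lin_iso[OF pHR presents_quot[OF pHP sub_T BP_T T_ZP]
        presents_quot[OF pHQ sub_K BQ_K K_ZQ] linear_ident _ q(1) _ lin])
    show "x \<in> ZP p" if "x \<in> ZR p" for x using that ZR_ZP by blast
    show "q x \<in> d ` ZQ (p - 1)" for x using BP_E q(2) by fastforce
    show "y \<in> K (p - 1)" if "y \<in> ZQ (p - 1)" "d y = 0" for y
      using that subspace_0[OF sub_BR] by (simp add: K_def)
  next
    fix x y assume x: "x \<in> ZR p" and y: "y \<in> ZQ (p - 1)" and eq: "q x = d y"
    show "x \<in> BR p \<longleftrightarrow> x \<in> T \<and> y \<in> K (p - 1)"
    proof
      assume "x \<in> BR p"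
      moreover then have "d y = x" using q(3)[of x] eq x BR_BP by auto
      ultimately show "x \<in> T \<and> y \<in> K (p - 1)" using BR_BP BP_T y by (auto simp: K_def)
    next
      assume *: "x \<in> T \<and> y \<in> K (p - 1)"
      obtain k where k: "k \<in> K p" "cP p x = \<sigma> (cQ p k)" using T_E * by blast
      have xR: "x \<in> R p" using x by (simp add: ZR_def)
      have xZ: "x \<in> ZP p" using x ZR_ZP by blast
      \<comment> \<open>The natural map undoes \<sigma>, and it sends the class of \<open>x\<close>
        to zero since \<open>x\<close> lies in \<open>R\<close>. So the image of \<sigma> meets the
        kernel of the natural map trivially.\<close>
      have "cQ p k = cQ p x" using \<sigma>_nat[OF cQ_ker[OF k(1)]] nat_map_cP[OF xZ] k(2) by simp
      also have "\<dots> = cQ p 0"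
        using presents_eq_iff[OF pK subsetD[OF ZP_K xZ] subspace_0[OF sub_K]] xR R_BQ by auto
      finally have "cP p x = cP p 0" using k(2) zero by simp
      then have "x \<in> BP p" using presents_eq_iff[OF pHP xZ subspace_0[OF sub_ZP]] by simp
      then have "x = d y" using q(3)[of x] x eq by simp
      then show "x \<in> BR p" using * by (simp add: K_def)
    qed
  next
    fix a e assume a: "a \<in> ZP p" and e: "e \<in> ZQ (p - 1)"
    have aK: "a \<in> K p" using a ZP_K by blast
    \<comment> \<open>\<open>b\<close> represents \<sigma> of the relative class of
      \<open>a\<close>. The difference \<open>a - b\<close> has zero relative class and so is a
      cocycle \<open>c\<close> of \<open>R\<close> up to a coboundary of \<open>P\<close>.\<close>
    obtain b where b: "b \<in> ZP p" "\<sigma> (cQ p a) = cP p b" using lift[OF cQ_ker[OF aK]] by blast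
    have "cQ p a = cQ p b" using \<sigma>_nat[OF cQ_ker[OF aK]] nat_map_cP[OF b(1)] b(2) by simp
    then have "a - b \<in> BQ p" using presents_eq_iff[OF pK aK subsetD[OF ZP_K b(1)]] by simp
    then obtain c w where cw: "a - b = c + w" "c \<in> R p" "w \<in> BP p" by (auto simp: BQ_def)
    have wZ: "w \<in> ZP p" using cw(3) BP_ZP by blast
    have c: "c \<in> ZR p"
    proof -
      have "c = a - b - w" using cw(1) by simp
      then have "c \<in> ZP p" using a b(1) wZ subspace_diff[OF sub_ZP] by auto
      then show ?thesis using cw(2) by (simp add: ZP_def ZR_def)
    qed
    have bT: "b \<in> T" using b cQ_ker[OF aK] by (auto simp: T_def image_iff intro!: bexI[of _ "cQ p a"])
    have qc: "q c \<in> ZR p \<inter> BP p" using q(2) by auto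
    \<comment> \<open>The correction \<open>d e - q c\<close> forces \<open>q x = d e\<close>; being
      a coboundary of \<open>P\<close> it lies in \<open>T\<close> and leaves the first component
      unchanged.\<close>
    define x where "x = c + (d e - q c)"
    have de: "d e - q c \<in> ZR p \<inter> BP p"
      using subspace_diff[OF subspace_inter[OF sub_ZR sub_BP] d_ZQ[OF e] qc] .
    have "x \<in> ZR p" unfolding x_def using subspace_add[OF sub_ZR c] de by blast
    moreover have "q x = d e"
      using q(3)[OF de] by (simp add: x_def linear_add[OF q(1)])
    moreover have "a - x = b + (w - (d e - q c))" using cw(1) by (simp add: x_def algebra_simps)
    moreover have "w - (d e - q c) \<in> T" using de BP_T subspace_diff[OF sub_BP cw(3)] by blast
    ultimately show "\<exists>x\<in>ZR p. \<exists>y\<in>ZQ (p - 1). a - x \<in> T \<and> q x = d y \<and> e - y \<in> K (p - 1)"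
      using e subspace_0[OF sub_K] subspace_add[OF sub_T bT] by (intro bexI[of _ x] bexI[of _ e]) auto
  qed
qed

end

section \<open>Calculus of multivector fields\<close>

lemma mfps_pd_add: "mfps_pd s (f + g) = mfps_pd s f + mfps_pd s g"
  by (rule mfps_eqI) (simp add: mfps_pd.rep_eq plus_mfps.rep_eq algebra_simps)

lemma mfps_pd_diff: "mfps_pd s (f - g) = mfps_pd s f - mfps_pd s g"
  by (rule mfps_eqI) (simp add: mfps_pd.rep_eq minus_mfps.rep_eq algebra_simps)

lemma mfps_pd_0: "mfps_pd s (0 :: 'n::finite mfps) = 0"
  using mfps_pd_diff[of s 0 0] by simp

lemma mfps_pd_1: "mfps_pd s (1 :: 'n::finite mfps) = 0"
  using mfps_pd_mult[of s 1 1] by simp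

lemma mfps_pd_scaleR: "mfps_pd s (c *\<^sub>R f) = c *\<^sub>R mfps_pd s f"
  by (rule mfps_eqI) (simp add: mfps_pd.rep_eq scaleR_mfps.rep_eq)

lemma mfps_pd_sum: "mfps_pd s (\<Sum>i\<in>A. f i) = (\<Sum>i\<in>A. mfps_pd s (f i :: 'n::finite mfps))"
  by (induction A rule: infinite_finite_induct) (auto simp: mfps_pd_0 mfps_pd_add)

lemma mfps_pd_commute: "mfps_pd s (mfps_pd t f) = mfps_pd t (mfps_pd s f)"
  by (rule mfps_eqI) (auto simp: mfps_pd.rep_eq lookup_add lookup_single when_def ac_simps)

lemma to_fract_eq_Fract: "to_fract a = Fract a 1"
  by (simp add: to_fract_def)

lemma fract_pd_add: "fract_pd s (p + q) = fract_pd s p + fract_pd s q"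
  by (cases p, cases q)
     (simp add: fract_pd_Fract eq_fract mfps_pd_add mfps_pd_mult algebra_simps)

lemma fract_pd_mult: "fract_pd s (p * q) = fract_pd s p * q + p * fract_pd s q"
  by (cases p, cases q)
     (simp add: fract_pd_Fract eq_fract mfps_pd_add mfps_pd_mult algebra_simps)

lemma fract_pd_to_fract: "fract_pd s (to_fract f) = to_fract (mfps_pd s f)"
  by (simp add: to_fract_eq_Fract fract_pd_Fract mfps_pd_1)

lemma fract_pd_1: "fract_pd s 1 = 0"
  using fract_pd_to_fract[of s 1] by (simp add: mfps_pd_1)

lemma fract_pd_sum: "fract_pd s (\<Sum>i\<in>A. f i) = (\<Sum>i\<in>A. fract_pd s (f i))"
  by (induction A rule: infinite_finite_induct) (auto simp: fract_pd_0 fract_pd_add)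

lemma fract_pd_scaleR: "fract_pd s (c *\<^sub>R q) = c *\<^sub>R fract_pd s q"
  by (simp add: scaleR_fract_def fract_pd_mult fract_pd_to_fract of_real_def mfps_pd_scaleR mfps_pd_1)

lemma scaleR_mvf: "c *\<^sub>R (v :: 'n::{finite,linorder} mvf) = to_fract (of_real c) *s v"
  by (simp add: vec_eq_iff scaleR_fract_def)

section \<open>The exterior product: bilinearity, associativity, anticommutation\<close>

lemma wedge_add_left: "wedge (u + v) w = wedge u w + wedge v w"
  by (simp add: wedge_def vec_eq_iff sum.distrib algebra_simps)

lemma wedge_add_right: "wedge u (v + w) = wedge u v + wedge u w"
  by (simp add: wedge_def vec_eq_iff sum.distrib algebra_simps)

lemma wedge_smult_left: "wedge (c *s u) v = c *s wedge u v"
  by (simp add: wedge_def vec_eq_iff sum_distrib_left algebra_simps)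

lemma wedge_smult_right: "wedge u (c *s v) = c *s wedge u v"
  by (simp add: wedge_def vec_eq_iff sum_distrib_left algebra_simps)

lemma wedge_0_left: "wedge 0 v = 0" and wedge_0_right: "wedge u 0 = 0"
  by (simp_all add: wedge_def vec_eq_iff)

lemma wedge_minus_right: "wedge u (- v) = - wedge u v"
  using wedge_smult_right[of u "-1" v] by (simp add: vec_eq_iff)

lemma wedge_minus_left: "wedge (- u) v = - wedge u v"
  using wedge_smult_left[of "-1" u v] by (simp add: vec_eq_iff)

lemma wedge_diff_right: "wedge u (v - w) = wedge u v - wedge u w"
  using wedge_add_right[of u v "- w"] by (simp add: wedge_minus_right)

lemma wedge_diff_left: "wedge (u - v) w = wedge u w - wedge v w"
  using wedge_add_left[of u "- v" w] by (simp add: wedge_minus_left)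

lemma wedge_sum_left: "wedge (\<Sum>i\<in>A. f i) v = (\<Sum>i\<in>A. wedge (f i) v)"
  by (induction A rule: infinite_finite_induct) (auto simp: wedge_0_left wedge_add_left)

lemma wedge_sum_right: "wedge u (\<Sum>i\<in>A. f i) = (\<Sum>i\<in>A. wedge u (f i))"
  by (induction A rule: infinite_finite_induct) (auto simp: wedge_0_right wedge_add_right)

text \<open>The sign exponent in \<open>wedge\<close> counts inversions between two index sets. Its
  additivity in each argument, here and in the next lemma, turns associativity of signs into
  arithmetic of exponents.\<close>

lemma card_inversions_Un_left:
  fixes A B C :: "'n::{finite,linorder} set"
  assumes "A \<inter> B = {}"
  shows "card {(i, j). i \<in> A \<union> B \<and> j \<in> C \<and> j < i} =
    card {(i, j). i \<in> A \<and> j \<in> C \<and> j < i} + card {(i, j). i \<in> B \<and> j \<in> C \<and> j < i}"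
proof -
  have "{(i, j). i \<in> A \<union> B \<and> j \<in> C \<and> j < i} =
    {(i, j). i \<in> A \<and> j \<in> C \<and> j < i} \<union> {(i, j). i \<in> B \<and> j \<in> C \<and> j < i}" by auto
  then show ?thesis using assms by (simp add: card_Un_disjoint disjoint_iff)
qed

lemma card_inversions_Un_right:
  fixes A B C :: "'n::{finite,linorder} set"
  assumes "B \<inter> C = {}"
  shows "card {(i, j). i \<in> A \<and> j \<in> B \<union> C \<and> j < i} =
    card {(i, j). i \<in> A \<and> j \<in> B \<and> j < i} + card {(i, j). i \<in> A \<and> j \<in> C \<and> j < i}"
proof -
  have "{(i, j). i \<in> A \<and> j \<in> B \<union> C \<and> j < i} =
    {(i, j). i \<in> A \<and> j \<in> B \<and> j < i} \<union> {(i, j). i \<in> A \<and> j \<in> C \<and> j < i}" by auto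
  then show ?thesis using assms by (simp add: card_Un_disjoint disjoint_iff)
qed

text \<open>Both sides sum over ordered partitions of \<open>K\<close> into three blocks, and on
  both the sign exponent counts the inversions between each of the three pairs of blocks.\<close>

lemma wedge_assoc: "wedge (wedge u v) w = wedge u (wedge v w)"
proof (unfold vec_eq_iff, rule allI)
  fix K
  define n where "n A B = card {(i, j). i \<in> A \<and> j \<in> B \<and> j < i}" for A B :: "'a set"
  have w: "wedge x y $ L = (\<Sum>I\<in>Pow L. (-1) ^ n I (L - I) * x $ I * y $ (L - I))" for x y :: "'a mvf" and L
    by (simp add: wedge_def n_def)
  have "wedge (wedge u v) w $ K = (\<Sum>I\<in>Pow K. \<Sum>J\<in>Pow I.
      (-1) ^ (n I (K - I) + n J (I - J)) * (u $ J * v $ (I - J) * w $ (K - I)))"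
    by (simp add: w sum_distrib_left sum_distrib_right power_add mult_ac)
  also have "\<dots> = (\<Sum>(I, J)\<in>Sigma (Pow K) Pow.
      (-1) ^ (n I (K - I) + n J (I - J)) * (u $ J * v $ (I - J) * w $ (K - I)))"
    by (rule sum.Sigma) auto
  also have "\<dots> = (\<Sum>(I, J)\<in>Sigma (Pow K) (\<lambda>I. Pow (K - I)).
      (-1) ^ (n I (K - I) + n J (K - I - J)) * (u $ I * v $ J * w $ (K - I - J)))"
  proof (rule sum.reindex_bij_witness[where i = "\<lambda>(I, J). (I \<union> J, I)" and j = "\<lambda>(I, J). (J, I - J)"],
      goal_cases)
    case (5 x)
    then obtain I J where x: "x = (I, J)" "I \<subseteq> K" "J \<subseteq> I" by auto
    have e: "I = J \<union> (I - J)" "K - J = (I - J) \<union> (K - I)" "K - J - (I - J) = K - I" using x by auto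
    have "n I (K - I) = n J (K - I) + n (I - J) (K - I)"
      using card_inversions_Un_left[of J "I - J" "K - I"] x(3) by (simp add: n_def Un_absorb1)
    moreover have "n J (K - J) = n J (I - J) + n J (K - I)"
      using card_inversions_Un_right[of "I - J" "K - I" J] e(2) by (auto simp: n_def)
    ultimately show ?case by (simp add: x(1) e(3) ac_simps)
  qed auto
  also have "\<dots> = (\<Sum>I\<in>Pow K. \<Sum>J\<in>Pow (K - I).
      (-1) ^ (n I (K - I) + n J (K - I - J)) * (u $ I * v $ J * w $ (K - I - J)))"
    by (rule sum.Sigma[symmetric]) auto
  also have "\<dots> = wedge u (wedge v w) $ K"
    by (simp add: w sum_distrib_left sum_distrib_right power_add mult_ac)
  finally show "wedge (wedge u v) w $ K = wedge u (wedge v w) $ K" .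
qed

lemma wedge_axis_empty: "wedge (axis {} c) u = c *s u"
proof (unfold vec_eq_iff, rule allI)
  fix K
  have "wedge (axis {} c) u $ K = (\<Sum>I\<in>{{} :: 'a set}. c * u $ K)"
    unfolding wedge_def vec_lambda_beta
    by (rule sum.mono_neutral_cong_right) (auto simp: axis_def)
  then show "wedge (axis {} c) u $ K = (c *s u) $ K" by simp
qed

lemma wedge_axis_nth:
  "wedge (axis {a} 1) w $ K = (if a \<in> K then (-1) ^ card {j \<in> K. j < a} * w $ (K - {a}) else 0)"
proof -
  have "wedge (axis {a} 1) w $ K =
    (\<Sum>I\<in>Pow K. if I = {a} then (-1) ^ card {(i, j). i \<in> I \<and> j \<in> K - I \<and> j < i} * w $ (K - I) else 0)"
    unfolding wedge_def vec_lambda_beta by (rule sum.cong) (auto simp: axis_def)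
  also have "\<dots> = (if a \<in> K then (-1) ^ card {(i, j). i \<in> {a} \<and> j \<in> K - {a} \<and> j < i} * w $ (K - {a}) else 0)"
    by (simp add: sum.delta)
  also have "{(i, j). i \<in> {a} \<and> j \<in> K - {a} \<and> j < i} = Pair a ` {j \<in> K. j < a}" by auto
  finally show ?thesis by (simp add: card_image inj_on_def)
qed

lemma card_less_remove:
  fixes a b :: "'n::{finite,linorder}"
  assumes "a \<in> K"
  shows "card {j \<in> K. j < b} = card {j \<in> K - {a}. j < b} + (if a < b then 1 else 0)"
proof (cases "a < b")
  case True
  then have "{j \<in> K. j < b} = insert a {j \<in> K - {a}. j < b}" using assms by auto
  then show ?thesis using True by simp
next
  case False
  then have "{j \<in> K. j < b} = {j \<in> K - {a}. j < b}" by auto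
  then show ?thesis using False by simp
qed

text \<open>If both indices lie in \<open>K\<close>, removing the smaller one lowers the position of
  the larger by one, while removing the larger does not move the smaller; the two orders differ by
  exactly one sign.\<close>

lemma wedge_axis_swap:
  "wedge (axis {a} 1) (wedge (axis {b} 1) w) = - wedge (axis {b} 1) (wedge (axis {a} 1) w)"
proof (unfold vec_eq_iff, rule allI)
  fix K
  have K: "K - {a} - {b} = K - {b} - {a}" by auto
  show "wedge (axis {a} 1) (wedge (axis {b} 1) w) $ K =
      (- wedge (axis {b} 1) (wedge (axis {a} 1) w)) $ K"
  proof (cases "a \<in> K \<and> b \<in> K \<and> a \<noteq> b")
    case True
    then have "a < b \<or> b < a" by auto
    then show ?thesis
      using True card_less_remove[of a K b] card_less_remove[of b K a]
      by (auto simp: wedge_axis_nth K)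
  qed (auto simp: wedge_axis_nth)
qed

section \<open>Contractions and vector fields\<close>

lemma left_deriv_add: "left_deriv s (u + v) = left_deriv s u + left_deriv s v"
  by (simp add: left_deriv_def vec_eq_iff algebra_simps)

lemma left_deriv_smult: "left_deriv s (c *s u) = c *s left_deriv s u"
  by (simp add: left_deriv_def vec_eq_iff algebra_simps)

lemma left_deriv_sum: "left_deriv s (\<Sum>i\<in>A. f i) = (\<Sum>i\<in>A. left_deriv s (f i))"
  by (induction A rule: infinite_finite_induct)
     (auto simp: left_deriv_add, simp_all add: left_deriv_def vec_eq_iff)

lemma right_deriv_add: "right_deriv s (u + v) = right_deriv s u + right_deriv s v"
  by (simp add: right_deriv_def vec_eq_iff algebra_simps)

lemma right_deriv_smult: "right_deriv s (c *s u) = c *s right_deriv s u"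
  by (simp add: right_deriv_def vec_eq_iff algebra_simps)

lemma right_deriv_sum: "right_deriv s (\<Sum>i\<in>A. f i) = (\<Sum>i\<in>A. right_deriv s (f i))"
  by (induction A rule: infinite_finite_induct)
     (auto simp: right_deriv_add, simp_all add: right_deriv_def vec_eq_iff)

text \<open>The canonical anticommutation relation of contraction and exterior multiplication. For
  \<open>s \<noteq> a\<close> the sign arises because exactly one of the two counts changes when the
  other index is inserted or removed.\<close>

lemma left_deriv_wedge_axis:
  "left_deriv s (wedge (axis {a} 1) w) = (if s = a then w else 0) - wedge (axis {a} 1) (left_deriv s w)"
proof (unfold vec_eq_iff, rule allI)
  fix K
  show "left_deriv s (wedge (axis {a} 1) w) $ K =
    ((if s = a then w else 0) - wedge (axis {a} 1) (left_deriv s w)) $ K"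
  proof (cases "s = a")
    case True
    show ?thesis
    proof (cases "a \<in> K")
      case K: True
      then show ?thesis using True card_less_remove[OF K, of a]
        by (simp add: left_deriv_def wedge_axis_nth insert_absorb flip: power_add mult_2)
    next
      case K: False
      then show ?thesis using True card_less_remove[of a "insert a K" a]
        by (simp add: left_deriv_def wedge_axis_nth flip: power_add mult_2 mult.assoc)
    qed
  next
    case False
    show ?thesis
    proof (cases "a \<in> K \<and> s \<notin> K")
      case K: True
      have e: "insert s K - {a} = insert s (K - {a})" using False by auto
      have "card {j \<in> insert s K. j < a} = card {j \<in> K. j < a} + (if s < a then 1 else 0)"
        using card_less_remove[of s "insert s K" a] K by simp
      moreover have "card {j \<in> K. j < s} = card {j \<in> K - {a}. j < s} + (if a < s then 1 else 0)"
        using card_less_remove[of a K s] K by simp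
      moreover have "a < s \<or> s < a" using False by auto
      ultimately show ?thesis using K False
        by (auto simp: left_deriv_def wedge_axis_nth e)
    qed (use False in \<open>auto simp: left_deriv_def wedge_axis_nth\<close>)
  qed
qed

lemma right_deriv_wedge_axis:
  "right_deriv s (wedge (axis {a} 1) (axis {b} 1)) =
    (if s = b then axis {a} 1 else 0) - (if s = a then axis {b} 1 else (0 :: 'n::{finite,linorder} mvf))"
proof (unfold vec_eq_iff, rule allI)
  fix K
  show "right_deriv s (wedge (axis {a} 1) (axis {b} 1)) $ K =
    ((if s = b then axis {a} 1 else 0) - (if s = a then axis {b} 1 else 0) :: 'n mvf) $ K"
  \<comment> \<open>The first case collects the components at which the left side can be nonzero,
    where \<open>insert s K = {a, b}\<close> with \<open>a \<noteq> b\<close>.\<close>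
  proof (cases "s \<notin> K \<and> a \<in> insert s K \<and> insert s K - {a} = {b}")
    case True
    then have ab: "a \<noteq> b" and K: "insert s K = {a, b}" and s: "s = a \<or> s = b" by auto
    have eq: "right_deriv s (wedge (axis {a} 1) (axis {b} 1) :: 'n mvf) $ K =
        (-1) ^ card {j \<in> K. s < j} * ((-1) ^ card {j \<in> insert s K. j < a} * axis {b} 1 $ {b})"
      using True by (simp add: right_deriv_def wedge_axis_nth)
    have ab': "a < b \<or> b < a" using ab by auto
    have K': "K = {a, b} - {s}" unfolding K[symmetric] using True by blast
    have ax: "(axis {c} 1 :: 'n mvf) $ {d} = (if d = c then 1 else 0)" for c d :: 'n
      by (auto simp: axis_def)
    from s show ?thesis
    proof
      assume sa: "s = a"
      have Kb: "K = {b}" using K' sa ab by auto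
      have "{j \<in> K. s < j} = (if a < b then {b} else {})"
        "{j \<in> insert s K. j < a} = (if b < a then {b} else {})"
        unfolding sa Kb by auto
      then have c: "card {j \<in> K. s < j} = (if a < b then 1 else 0)"
        "card {j \<in> insert s K. j < a} = (if b < a then 1 else 0)" by simp_all
      show ?thesis unfolding eq c unfolding sa Kb using ab ab'
        by (elim disjE) (simp_all add: ax)
    next
      assume sb: "s = b"
      have Kb: "K = {a}" using K' sb ab by auto
      have "{j \<in> K. s < j} = (if b < a then {a} else {})"
        "{j \<in> insert s K. j < a} = (if b < a then {b} else {})"
        unfolding sb Kb by auto
      then have c: "card {j \<in> K. s < j} = (if b < a then 1 else 0)"
        "card {j \<in> insert s K. j < a} = (if b < a then 1 else 0)" by simp_all
      show ?thesis unfolding eq c unfolding sb Kb using ab ab'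
        by (elim disjE) (simp_all add: ax)
    qed
  next
    case False
    have "(axis {b} 1 :: 'n mvf) $ L = 0 \<or> L = {b}" for L by (simp add: axis_def)
    with False have "(axis {b} 1 :: 'n mvf) $ (insert s K - {a}) = 0 \<or> s \<in> K \<or> a \<notin> insert s K"
      by blast
    then have "right_deriv s (wedge (axis {a} 1) (axis {b} 1) :: 'n mvf) $ K = 0"
      unfolding right_deriv_def vec_lambda_beta wedge_axis_nth
      by (elim disjE) (simp_all only: if_True if_False mult_zero_right if_cancel)
    moreover have "((if s = b then axis {a} 1 else 0) - (if s = a then axis {b} 1 else 0) :: 'n mvf) $ K = 0"
    proof (rule ccontr)
      assume "\<not> ?thesis"
      then have "a \<noteq> b \<and> (s = b \<and> K = {a} \<or> s = a \<and> K = {b})"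
        by (simp add: axis_def split: if_splits)
      then have "s \<notin> K \<and> a \<in> insert s K \<and> insert s K - {a} = {b}" by (elim conjE disjE) auto
      with False show False by contradiction
    qed
    ultimately show ?thesis by simp
  qed
qed

lemma vector_field_add: "vector_field (\<lambda>s. X s + Y s) = vector_field X + vector_field Y"
  by (simp add: vec_eq_iff vector_field_nth)

lemma vector_field_diff: "vector_field (\<lambda>s. X s - Y s) = vector_field X - vector_field Y"
  by (simp add: vec_eq_iff vector_field_nth)

lemma vector_field_smult: "vector_field (\<lambda>s. c * X s) = c *s vector_field X"
  by (simp add: vec_eq_iff vector_field_nth)

lemma vector_field_sum:
  "vector_field (\<lambda>s. \<Sum>i\<in>A. X i s) = (\<Sum>i\<in>A. vector_field (X i))"
  by (induction A rule: infinite_finite_induct)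
     (auto simp: vector_field_add, simp_all add: vec_eq_iff vector_field_nth)

lemma wedge_vector_field_left: "wedge (vector_field X) w = (\<Sum>a\<in>UNIV. X a *s wedge (axis {a} 1) w)"
  by (simp add: vector_field_def wedge_sum_left wedge_smult_left)

lemma wedge_vector_field_right: "wedge w (vector_field X) = (\<Sum>a\<in>UNIV. X a *s wedge w (axis {a} 1))"
  by (simp add: vector_field_def wedge_sum_right wedge_smult_right)

lemma smult_sum_mvf: "c *s (\<Sum>i\<in>A. f i) = (\<Sum>i\<in>A. c *s (f i :: 'n::{finite,linorder} mvf))"
  by (simp add: vec_eq_iff sum_distrib_left)

lemma wedge_vector_field_swap:
  "wedge (vector_field X) (wedge (vector_field Y) w) =
   - wedge (vector_field Y) (wedge (vector_field X) w)"
proof -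
  have "wedge (vector_field X) (wedge (vector_field Y) w) =
      (\<Sum>b\<in>UNIV. \<Sum>a\<in>UNIV. (X a * Y b) *s wedge (axis {a} 1) (wedge (axis {b} 1) w))"
    by (simp add: wedge_vector_field_left wedge_sum_right wedge_smult_right smult_sum_mvf
        vector_smult_assoc mult.commute)
  also have "\<dots> = (\<Sum>b\<in>UNIV. \<Sum>a\<in>UNIV. - ((Y b * X a) *s wedge (axis {b} 1) (wedge (axis {a} 1) w)))"
    by (intro sum.cong refl, subst wedge_axis_swap) (simp add: mult.commute vec_eq_iff)
  also have "\<dots> = - wedge (vector_field Y) (wedge (vector_field X) w)"
    by (subst sum.swap) (simp add: wedge_vector_field_left wedge_sum_right wedge_smult_right
        smult_sum_mvf vector_smult_assoc sum_negf mult.commute)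
  finally show ?thesis .
qed

text \<open>Halving in a real vector space. It turns anticommutation into vanishing, both for the
  exterior square of a field and for the square of the differential.\<close>

lemma mvf_eq_minus_self: "v = - v \<Longrightarrow> v = (0 :: 'n::{finite,linorder} mvf)"
  by (metis add.right_inverse scaleR_2 scaleR_eq_0_iff zero_neq_numeral)

lemma wedge_vector_field_self: "wedge (vector_field X) (wedge (vector_field X) w) = 0"
  by (rule mvf_eq_minus_self) (rule wedge_vector_field_swap)

lemma left_deriv_wedge_vector_field:
  "left_deriv s (wedge (vector_field X) w) = X s *s w - wedge (vector_field X) (left_deriv s w)"
proof -
  have "left_deriv s (wedge (vector_field X) w) =
      (\<Sum>a\<in>UNIV. (if a = s then X s *s w else 0) - X a *s wedge (axis {a} 1) (left_deriv s w))"
    unfolding wedge_vector_field_left left_deriv_sum left_deriv_smult left_deriv_wedge_axis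
    by (rule sum.cong) (auto simp: vec_eq_iff right_diff_distrib)
  then show ?thesis by (simp add: sum_subtractf wedge_vector_field_left sum.delta)
qed

lemma right_deriv_wedge_vector_field:
  "right_deriv s (wedge (vector_field X) (vector_field Y)) =
   Y s *s vector_field X - X s *s vector_field Y"
proof -
  have "right_deriv s (wedge (vector_field X) (vector_field Y)) =
     (\<Sum>a\<in>UNIV. \<Sum>b\<in>UNIV. (X a * Y b) *s right_deriv s (wedge (axis {a} 1) (axis {b} 1)))"
    by (subst sum.swap) (simp add: wedge_vector_field_left wedge_vector_field_right right_deriv_sum
        right_deriv_smult smult_sum_mvf vector_smult_assoc mult.commute)
  also have "\<dots> = (\<Sum>a\<in>UNIV. \<Sum>b\<in>UNIV. (if b = s then (X a * Y s) *s axis {a} 1 else 0) -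
      (if a = s then (X s * Y b) *s axis {b} 1 else 0))"
    unfolding right_deriv_wedge_axis
    by (intro sum.cong refl) (auto simp: vec_eq_iff right_diff_distrib)
  also have "\<dots> = (\<Sum>a\<in>UNIV. (X a * Y s) *s axis {a} 1) - (\<Sum>b\<in>UNIV. (X s * Y b) *s axis {b} 1)"
  proof -
    have "(\<Sum>a\<in>UNIV. \<Sum>b\<in>UNIV. if a = s then (X s * Y b) *s axis {b} 1 else (0 :: 'a mvf)) =
        (\<Sum>b\<in>UNIV. (X s * Y b) *s axis {b} 1)"
      by (subst sum.swap) simp
    then show ?thesis by (simp add: sum_subtractf)
  qed
  also have "\<dots> = Y s *s vector_field X - X s *s vector_field Y"
    by (simp add: vector_field_def smult_sum_mvf vector_smult_assoc mult.commute)
  finally show ?thesis .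
qed

section \<open>Leibniz rules for the bracket\<close>

lemma mvf_pd_add: "mvf_pd s (u + v) = mvf_pd s u + mvf_pd s v"
  by (simp add: mvf_pd_def vec_eq_iff fract_pd_add)

lemma mvf_pd_smult: "mvf_pd s (c *s u) = fract_pd s c *s u + c *s mvf_pd s u"
  by (simp add: mvf_pd_def vec_eq_iff fract_pd_mult)

lemma mvf_pd_scaleR: "mvf_pd s (c *\<^sub>R u) = c *\<^sub>R mvf_pd s u"
  by (simp add: mvf_pd_def vec_eq_iff fract_pd_scaleR)

lemma mvf_pd_vector_field: "mvf_pd s (vector_field X) = vector_field (\<lambda>t. fract_pd s (X t))"
  by (simp add: mvf_pd_def vec_eq_iff vector_field_nth fract_pd_0)

lemma fract_pd_minus: "fract_pd s (- q) = - fract_pd s q"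
  using fract_pd_add[of s q "- q"] by (simp add: fract_pd_0 eq_neg_iff_add_eq_0 add.commute)

lemma fract_pd_neg_one_power: "fract_pd s ((-1) ^ k) = 0"
  by (induction k) (auto simp: fract_pd_minus fract_pd_1)

lemma mvf_pd_wedge: "mvf_pd s (wedge u v) = wedge (mvf_pd s u) v + wedge u (mvf_pd s v)"
  by (simp add: mvf_pd_def vec_eq_iff wedge_def fract_pd_sum fract_pd_neg_one_power
      fract_pd_mult sum.distrib algebra_simps)

lemma sn_bracket_add_right: "sn_bracket u (v + w) = sn_bracket u v + sn_bracket u w"
  by (simp add: sn_bracket_def mvf_pd_add left_deriv_add wedge_add_right sum.distrib[symmetric]
      algebra_simps)

lemma sn_bracket_add_left: "sn_bracket (u + v) w = sn_bracket u w + sn_bracket v w"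
  by (simp add: sn_bracket_def mvf_pd_add right_deriv_add wedge_add_left sum.distrib[symmetric]
      algebra_simps)

lemma sn_bracket_scaleR_right: "sn_bracket u (c *\<^sub>R v) = c *\<^sub>R sn_bracket u v"
proof -
  have "wedge x (c *\<^sub>R y) = c *\<^sub>R wedge x y" "left_deriv s (c *\<^sub>R y) = c *\<^sub>R left_deriv s y"
    for x y :: "'a mvf" and s
    by (simp_all add: scaleR_mvf wedge_smult_right left_deriv_smult)
  then show ?thesis
    by (simp add: sn_bracket_def mvf_pd_scaleR scaleR_sum_right scaleR_diff_right)
qed

lemma sn_bracket_scaleR_left: "sn_bracket (c *\<^sub>R u) v = c *\<^sub>R sn_bracket u v"
proof -
  have "wedge (c *\<^sub>R x) y = c *\<^sub>R wedge x y" "right_deriv s (c *\<^sub>R y) = c *\<^sub>R right_deriv s y"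
    for x y :: "'a mvf" and s
    by (simp_all add: scaleR_mvf wedge_smult_left right_deriv_smult)
  then show ?thesis
    by (simp add: sn_bracket_def mvf_pd_scaleR scaleR_sum_right scaleR_diff_right)
qed

lemma linear_sn_bracket: "linear (sn_bracket u)"
  by (rule linearI) (simp_all add: sn_bracket_add_right sn_bracket_scaleR_right)

lemma sn_bracket_sum_left: "sn_bracket (\<Sum>i\<in>A. f i) v = (\<Sum>i\<in>A. sn_bracket (f i) v)"
proof -
  have "linear (\<lambda>u. sn_bracket u v)"
    by (rule linearI) (simp_all add: sn_bracket_add_left sn_bracket_scaleR_left)
  then show ?thesis by (rule linear_sum)
qed

text \<open>The right derivative of a vector field is the scalar \<open>X s\<close>, so the bracket
  becomes the Lie derivative in coordinates: transport of coefficients minus the action of the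
  Jacobian of \<open>X\<close> on the generators.\<close>

lemma sn_bracket_vector_field_left:
  "sn_bracket (vector_field X) v =
   (\<Sum>s\<in>UNIV. X s *s mvf_pd s v - wedge (vector_field (\<lambda>t. fract_pd s (X t))) (left_deriv s v))"
proof -
  have "right_deriv s (vector_field X) = axis {} (X s)" for s
    by (auto simp: right_deriv_def vector_field_nth vec_eq_iff axis_def)
  then show ?thesis
    by (simp add: sn_bracket_def wedge_axis_empty mvf_pd_vector_field)
qed

lemma sn_bracket_vector_field_unit: "sn_bracket (vector_field X) (axis {} 1) = 0"
proof -
  have "mvf_pd s (axis {} 1 :: 'a mvf) = 0" "left_deriv s (axis {} 1 :: 'a mvf) = 0" for s
    by (auto simp: mvf_pd_def left_deriv_def vec_eq_iff axis_def fract_pd_0 fract_pd_1)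
  then show ?thesis by (simp add: sn_bracket_vector_field_left wedge_0_right)
qed

lemma sn_bracket_vector_field_smult:
  "sn_bracket (vector_field X) (c *s v) =
   (\<Sum>s\<in>UNIV. X s * fract_pd s c) *s v + c *s sn_bracket (vector_field X) v"
proof -
  have "sn_bracket (vector_field X) (c *s v) = (\<Sum>s\<in>UNIV. (X s * fract_pd s c) *s v +
      c *s (X s *s mvf_pd s v - wedge (vector_field (\<lambda>t. fract_pd s (X t))) (left_deriv s v)))"
    unfolding sn_bracket_vector_field_left mvf_pd_smult left_deriv_smult wedge_smult_right
    by (rule sum.cong) (auto simp: vec_eq_iff algebra_simps)
  also have "\<dots> = (\<Sum>s\<in>UNIV. X s * fract_pd s c) *s v + c *s sn_bracket (vector_field X) v"
    unfolding sum.distrib smult_sum_mvf[symmetric] sn_bracket_vector_field_left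
    by (simp add: vec_eq_iff sum_distrib_right)
  finally show ?thesis .
qed

text \<open>The term \<open>Y s *s w\<close> from contracting the product completes the Lie bracket
  of \<open>X\<close> and \<open>Y\<close>. The other term carries the sign of the antiderivation,
  which matches the sign from moving the derivative of \<open>X\<close> past
  \<open>Y\<close>.\<close>

lemma sn_bracket_vector_field_wedge:
  "sn_bracket (vector_field X) (wedge (vector_field Y) w) =
   wedge (sn_bracket (vector_field X) (vector_field Y)) w +
   wedge (vector_field Y) (sn_bracket (vector_field X) w)"
proof -
  let ?dX = "\<lambda>s. vector_field (\<lambda>t. fract_pd s (X t))"
  let ?dY = "\<lambda>s. vector_field (\<lambda>t. fract_pd s (Y t))"
  have "sn_bracket (vector_field X) (vector_field Y) = (\<Sum>s\<in>UNIV. X s *s ?dY s - Y s *s ?dX s)"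
    unfolding sn_bracket_vector_field vector_field_sum vector_field_diff vector_field_smult ..
  then have 1: "wedge (sn_bracket (vector_field X) (vector_field Y)) w =
      (\<Sum>s\<in>UNIV. X s *s wedge (?dY s) w - Y s *s wedge (?dX s) w)"
    by (simp add: wedge_sum_left wedge_diff_left wedge_smult_left)
  have 2: "wedge (vector_field Y) (sn_bracket (vector_field X) w) =
      (\<Sum>s\<in>UNIV. X s *s wedge (vector_field Y) (mvf_pd s w) +
        wedge (?dX s) (wedge (vector_field Y) (left_deriv s w)))"
    unfolding sn_bracket_vector_field_left wedge_sum_right wedge_diff_right wedge_smult_right
    by (intro sum.cong refl, subst wedge_vector_field_swap) simp
  have "sn_bracket (vector_field X) (wedge (vector_field Y) w) =
      (\<Sum>s\<in>UNIV. (X s *s wedge (?dY s) w - Y s *s wedge (?dX s) w) +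
        (X s *s wedge (vector_field Y) (mvf_pd s w) +
        wedge (?dX s) (wedge (vector_field Y) (left_deriv s w))))"
    unfolding sn_bracket_vector_field_left mvf_pd_wedge mvf_pd_vector_field
      left_deriv_wedge_vector_field wedge_diff_right wedge_smult_right
    by (rule sum.cong) (auto simp: vec_eq_iff algebra_simps)
  then show ?thesis unfolding 1 2 by (simp add: sum.distrib)
qed

text \<open>This reduces the differential to Lie derivatives along the fields in \<Lambda>. The
  right derivative strips the last factor without sign, leaving \<open>X\<close> with the derivative
  along \<open>Y\<close>; stripping the first factor costs the minus sign.\<close>

lemma sn_bracket_bivector:
  "sn_bracket (wedge (vector_field X) (vector_field Y)) v =
   wedge (vector_field X) (sn_bracket (vector_field Y) v) -
   wedge (vector_field Y) (sn_bracket (vector_field X) v)"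
proof -
  let ?dX = "\<lambda>s. vector_field (\<lambda>t. fract_pd s (X t))"
  let ?dY = "\<lambda>s. vector_field (\<lambda>t. fract_pd s (Y t))"
  have "sn_bracket (wedge (vector_field X) (vector_field Y)) v =
      (\<Sum>s\<in>UNIV. (Y s *s wedge (vector_field X) (mvf_pd s v)
          - wedge (vector_field X) (wedge (?dY s) (left_deriv s v)))
        - (X s *s wedge (vector_field Y) (mvf_pd s v)
          - wedge (vector_field Y) (wedge (?dX s) (left_deriv s v))))"
    unfolding sn_bracket_def right_deriv_wedge_vector_field mvf_pd_wedge mvf_pd_vector_field
      wedge_diff_left wedge_add_left wedge_smult_left wedge_assoc
    by (intro sum.cong refl, subst wedge_vector_field_swap[of "\<lambda>t. fract_pd _ (X t)"]) simp
  then show ?thesis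
    unfolding sn_bracket_vector_field_left
    by (simp add: wedge_sum_right wedge_diff_right wedge_smult_right sum_subtractf)
qed

text \<open>Every exchange with a preceding factor costs a sign. The total sign is left open, since
  the result only feeds membership in a subspace, which is closed under negation.\<close>

lemma wedge_fold_wedge_insort:
  fixes Y :: "'n::{finite,linorder} \<Rightarrow> 'n \<Rightarrow> 'n mfps fract"
  defines "F \<equiv> \<lambda>xs. foldr wedge (map (\<lambda>i. vector_field (Y i)) xs) (axis {} 1)"
  shows "wedge (vector_field (Y j)) (F xs) = F (insort j xs) \<or>
    wedge (vector_field (Y j)) (F xs) = - F (insort j xs)"
proof (induction xs)
  case (Cons a xs)
  have "wedge (vector_field (Y j)) (F (a # xs)) =
      - wedge (vector_field (Y a)) (wedge (vector_field (Y j)) (F xs))"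
    unfolding F_def by (simp, rule wedge_vector_field_swap)
  with Cons show ?case
    by (auto simp: F_def wedge_minus_right)
qed (simp add: F_def)

lemma wedge_fold_wedge_mem:
  "j \<in> set xs \<Longrightarrow>
    wedge (vector_field (Y j)) (foldr wedge (map (\<lambda>i. vector_field (Y i)) xs) (axis {} 1)) = 0"
proof (induction xs)
  case (Cons a xs)
  show ?case
  proof (cases "j = a")
    case True
    then show ?thesis by (simp add: wedge_vector_field_self)
  next
    case False
    with Cons show ?thesis
      by (simp, subst wedge_vector_field_swap) (simp add: wedge_0_right)
  qed
qed simp

section \<open>Homogeneous power series and the determinant\<close>

lemma homogeneous_0: "0 \<in> homogeneous r"
  by (simp add: homogeneous_def zero_mfps.rep_eq)

lemma homogeneous_add: "f \<in> homogeneous r \<Longrightarrow> g \<in> homogeneous r \<Longrightarrow> f + g \<in> homogeneous r"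
  by (simp add: homogeneous_def plus_mfps.rep_eq) (metis add_0)

lemma homogeneous_diff: "f \<in> homogeneous r \<Longrightarrow> g \<in> homogeneous r \<Longrightarrow> f - g \<in> homogeneous r"
  by (simp add: homogeneous_def minus_mfps.rep_eq) (metis diff_self)

lemma homogeneous_scaleR: "f \<in> homogeneous r \<Longrightarrow> c *\<^sub>R f \<in> homogeneous r"
  by (simp add: homogeneous_def scaleR_mfps.rep_eq)

lemma homogeneous_sum: "(\<And>i. i \<in> A \<Longrightarrow> f i \<in> homogeneous r) \<Longrightarrow> (\<Sum>i\<in>A. f i) \<in> homogeneous r"
  by (induction A rule: infinite_finite_induct) (auto simp: homogeneous_0 homogeneous_add)

lemma mdeg_add: "mdeg (a + b) = mdeg a + mdeg b"
  by (simp add: mdeg_def lookup_add sum.distrib)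

lemma mdeg_single: "mdeg (Poly_Mapping.single (s :: 'n::finite) k) = k"
proof -
  have "mdeg (Poly_Mapping.single s k) = (\<Sum>i\<in>UNIV. if i = s then k else 0)"
    unfolding mdeg_def by (rule sum.cong) (auto simp: lookup_single when_def)
  then show ?thesis by simp
qed

lemma homogeneous_mult:
  assumes "f \<in> homogeneous a" "g \<in> homogeneous b"
  shows "f * g \<in> homogeneous (a + b)"
  unfolding homogeneous_def
proof (intro CollectI allI impI)
  fix m assume "mcoeff (f * g) m \<noteq> 0"
  then obtain x where "x \<in> {(i, j). i + j = m}" "(case x of (i, j) \<Rightarrow> mcoeff f i * mcoeff g j) \<noteq> 0"
    unfolding times_mfps.rep_eq by (meson sum.not_neutral_contains_not_neutral)
  then obtain i j where "i + j = m" "mcoeff f i \<noteq> 0" "mcoeff g j \<noteq> 0" by auto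
  with assms show "mdeg m = a + b" by (auto simp: homogeneous_def mdeg_add)
qed

text \<open>Truncated subtraction makes \<open>r - 1\<close> equal to 0 at \<open>r = 0\<close>, so
  the vanishing of derivatives of constants is recorded separately.\<close>

lemma homogeneous_mfps_pd:
  fixes f :: "'n::finite mfps"
  assumes "f \<in> homogeneous r"
  shows "mfps_pd s f \<in> homogeneous (r - 1)" and "r = 0 \<Longrightarrow> mfps_pd s f = 0"
proof -
  have *: "mdeg m + 1 = r" if "mcoeff (mfps_pd s f) m \<noteq> 0" for m
    using that assms by (force simp: homogeneous_def mfps_pd.rep_eq mdeg_add mdeg_single)
  then show "mfps_pd s f \<in> homogeneous (r - 1)" by (force simp: homogeneous_def)
  show "mfps_pd s f = 0" if "r = 0"
    using * that by (intro mfps_eqI) (fastforce simp: zero_mfps.rep_eq)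
qed

section \<open>Jacobi's formula for a derivation of a commutative ring\<close>

lemma additive_derivation_prod:
  fixes \<delta> :: "'a::comm_ring_1 \<Rightarrow> 'a"
  assumes mult: "\<And>x y. \<delta> (x * y) = \<delta> x * y + x * \<delta> y" and fin: "finite A"
  shows "\<delta> (\<Prod>i\<in>A. f i) = (\<Sum>k\<in>A. \<Prod>i\<in>A. if i = k then \<delta> (f i) else f i)"
  using fin
proof induction
  case empty
  show ?case using mult[of 1 1] by simp
next
  case (insert a A)
  have 1: "(\<Prod>i\<in>A. if i = a then \<delta> (f i) else f i) = (\<Prod>i\<in>A. f i)"
    by (rule prod.cong) (use insert in auto)
  have 2: "(\<Prod>i\<in>insert a A. if i = k then \<delta> (f i) else f i) =
      f a * (\<Prod>i\<in>A. if i = k then \<delta> (f i) else f i)" if "k \<in> A" for k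
    using insert that by auto
  have "\<delta> (\<Prod>i\<in>insert a A. f i) = \<delta> (f a) * (\<Prod>i\<in>A. f i) +
      f a * (\<Sum>k\<in>A. \<Prod>i\<in>A. if i = k then \<delta> (f i) else f i)"
    using insert by (simp add: mult)
  also have "f a * (\<Sum>k\<in>A. \<Prod>i\<in>A. if i = k then \<delta> (f i) else f i) =
      (\<Sum>k\<in>A. \<Prod>i\<in>insert a A. if i = k then \<delta> (f i) else f i)"
    unfolding sum_distrib_left by (rule sum.cong) (simp_all only: 2)
  finally show ?case using insert 1 by simp
qed

lemma derivation_det:
  fixes \<delta> :: "'a::comm_ring_1 \<Rightarrow> 'a" and A :: "(('a, 'n::finite) vec, 'n) vec"
  assumes add: "\<And>x y. \<delta> (x + y) = \<delta> x + \<delta> y"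
    and mult: "\<And>x y. \<delta> (x * y) = \<delta> x * y + x * \<delta> y"
  shows "\<delta> (det A) = (\<Sum>k\<in>UNIV. det (\<chi> i. if i = k then (\<chi> j. \<delta> (A $ i $ j)) else A $ i))"
proof -
  have z: "\<delta> 0 = 0" using add[of 0 0] by simp
  have sum: "\<delta> (\<Sum>x\<in>S. g x) = (\<Sum>x\<in>S. \<delta> (g x))" for g :: "('n \<Rightarrow> 'n) \<Rightarrow> 'a" and S
    by (induction S rule: infinite_finite_induct) (auto simp: z add)
  have one: "\<delta> 1 = 0" using mult[of 1 1] by simp
  have neg: "\<delta> (- x) = - \<delta> x" for x using add[of x "- x"] z by (simp add: eq_neg_iff_add_eq_0 add.commute)
  have sgn: "\<delta> (of_int (sign p) * x) = of_int (sign p) * \<delta> x" for p :: "'n \<Rightarrow> 'n" and x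
    by (cases "evenperm p") (auto simp: sign_def neg)
  have "\<delta> (det A) = (\<Sum>p | p permutes UNIV. \<Sum>k\<in>UNIV.
      of_int (sign p) * (\<Prod>i\<in>UNIV. if i = k then \<delta> (A $ i $ p i) else A $ i $ p i))"
    unfolding det_def sum sgn additive_derivation_prod[OF mult finite_class.finite_UNIV] sum_distrib_left ..
  also have "\<dots> = (\<Sum>k\<in>UNIV. \<Sum>p | p permutes UNIV.
      of_int (sign p) * (\<Prod>i\<in>UNIV. if i = k then \<delta> (A $ i $ p i) else A $ i $ p i))"
    by (rule sum.swap)
  also have "\<dots> = (\<Sum>k\<in>UNIV. det (\<chi> i. if i = k then (\<chi> j. \<delta> (A $ i $ j)) else A $ i))"
    unfolding det_def by (intro sum.cong refl arg_cong2[where f = "(*)"] prod.cong) auto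
  finally show ?thesis .
qed

text \<open>Jacobi's formula when \<delta> acts on the matrix by right multiplication with
  \<open>M\<close>. This combines columns, hence the passage to the transpose, where the determinant
  expands by rows; of each replaced row only the multiple of the original row survives, as the other
  terms have a repeated row.\<close>

lemma derivation_det_eq_trace:
  fixes \<delta> :: "'a::comm_ring_1 \<Rightarrow> 'a" and A :: "(('a, 'n::finite) vec, 'n) vec"
  assumes add: "\<And>x y. \<delta> (x + y) = \<delta> x + \<delta> y"
    and mult: "\<And>x y. \<delta> (x * y) = \<delta> x * y + x * \<delta> y"
    and M: "\<And>i j. \<delta> (A $ i $ j) = (\<Sum>k\<in>UNIV. A $ i $ k * M k j)"
  shows "\<delta> (det A) = (\<Sum>k\<in>UNIV. M k k) * det A"
proof -
  define B where "B = transpose A"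
  have row: "(\<chi> j. \<delta> (B $ i $ j)) = (\<Sum>k\<in>UNIV. M k i *s B $ k)" for i
    by (simp add: B_def transpose_def vec_eq_iff M mult.commute)
  have "det (\<chi> i. if i = k then (\<chi> j. \<delta> (B $ i $ j)) else B $ i) = M k k * det B" for k
  proof -
    have "det (\<chi> i. if i = k then (\<chi> j. \<delta> (B $ i $ j)) else B $ i) =
        (\<Sum>m\<in>UNIV. M m k * det (\<chi> i. if i = k then B $ m else B $ i))"
    proof -
      have "(\<chi> i. if i = k then (\<chi> j. \<delta> (B $ i $ j)) else B $ i) =
          (\<chi> i. if i = k then (\<Sum>m\<in>UNIV. M m k *s B $ m) else B $ i)"
        by (rule arg_cong[where f = vec_lambda], rule ext) (auto simp: row)
      then show ?thesis
        by (simp only: det_linear_row_sum[OF finite_class.finite_UNIV] det_row_mul)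
    qed
    also have "\<dots> = (\<Sum>m\<in>UNIV. if m = k then M k k * det B else 0)"
    proof (rule sum.cong)
      fix m
      show "M m k * det (\<chi> i. if i = k then B $ m else B $ i) = (if m = k then M k k * det B else 0)"
      proof (cases "m = k")
        case True
        have "(\<chi> i. if i = k then B $ m else B $ i) = B" using True by (simp add: vec_eq_iff)
        then show ?thesis using True by simp
      next
        case False
        have "det (\<chi> i. if i = k then B $ m else B $ i) = 0"
          by (rule det_identical_rows[of k m]) (use False in \<open>auto simp: row_def\<close>)
        then show ?thesis using False by simp
      qed
    qed simp
    finally show ?thesis by simp
  qed
  then have "\<delta> (det B) = (\<Sum>k\<in>UNIV. M k k) * det B"
    using derivation_det[OF add mult, of B] by (simp add: sum_distrib_right)
  then show ?thesis by (simp add: B_def)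
qed

section \<open>The differential on potential cochains\<close>

lemma range_to_fract_closed:
  "0 \<in> range to_fract" "1 \<in> range to_fract"
  "x \<in> range to_fract \<Longrightarrow> y \<in> range to_fract \<Longrightarrow> x + y \<in> range to_fract"
  "x \<in> range to_fract \<Longrightarrow> y \<in> range to_fract \<Longrightarrow> x - y \<in> range to_fract"
  "x \<in> range to_fract \<Longrightarrow> y \<in> range to_fract \<Longrightarrow> x * y \<in> range to_fract"
  "x \<in> range to_fract \<Longrightarrow> - x \<in> range to_fract"
  by (metis rangeI to_fract_0, metis rangeI to_fract_1)
     (auto simp flip: to_fract_add to_fract_diff to_fract_mult to_fract_uminus)

lemma range_to_fract_signed: "x \<in> range to_fract \<Longrightarrow> (-1) ^ k * x \<in> range to_fract"
  by (induction k) (auto intro: range_to_fract_closed)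

lemma range_to_fract_sum:
  "(\<And>i. i \<in> A \<Longrightarrow> f i \<in> range to_fract) \<Longrightarrow> (\<Sum>i\<in>A. f i) \<in> range to_fract"
  by (induction A rule: infinite_finite_induct) (auto intro: range_to_fract_closed)

lemma formal_cochains_add: "u \<in> formal_cochains \<Longrightarrow> v \<in> formal_cochains \<Longrightarrow> u + v \<in> formal_cochains"
  by (auto simp: formal_cochains_def intro: range_to_fract_closed(3))

lemma formal_cochains_diff: "u \<in> formal_cochains \<Longrightarrow> v \<in> formal_cochains \<Longrightarrow> u - v \<in> formal_cochains"
  by (auto simp: formal_cochains_def intro: range_to_fract_closed(4))

lemma formal_cochains_0: "0 \<in> formal_cochains"
  by (auto simp: formal_cochains_def intro: range_to_fract_closed(1))

lemma formal_cochains_scaleR: "v \<in> formal_cochains \<Longrightarrow> c *\<^sub>R v \<in> formal_cochains"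
  by (auto simp: formal_cochains_def scaleR_mvf intro!: range_to_fract_closed(5))

lemma formal_cochains_sum:
  "(\<And>i. i \<in> A \<Longrightarrow> f i \<in> formal_cochains) \<Longrightarrow> (\<Sum>i\<in>A. f i) \<in> formal_cochains"
  by (induction A rule: infinite_finite_induct) (auto simp: formal_cochains_0 formal_cochains_add)

lemma formal_cochains_wedge:
  "u \<in> formal_cochains \<Longrightarrow> v \<in> formal_cochains \<Longrightarrow> wedge u v \<in> formal_cochains"
  unfolding formal_cochains_def wedge_def
  by (simp add: mult.assoc) (intro allI range_to_fract_sum range_to_fract_signed range_to_fract_closed(5), auto)

lemma formal_cochains_pd: "u \<in> formal_cochains \<Longrightarrow> mvf_pd s u \<in> formal_cochains"
  unfolding formal_cochains_def mvf_pd_def by (simp, metis fract_pd_to_fract imageE rangeI)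

lemma formal_cochains_left_deriv: "u \<in> formal_cochains \<Longrightarrow> left_deriv s u \<in> formal_cochains"
  by (simp add: formal_cochains_def left_deriv_def range_to_fract_signed range_to_fract_closed(1))

lemma formal_cochains_right_deriv: "u \<in> formal_cochains \<Longrightarrow> right_deriv s u \<in> formal_cochains"
  by (simp add: formal_cochains_def right_deriv_def range_to_fract_signed range_to_fract_closed(1))

text \<open>The coordinate formula uses only ring operations and partial derivatives, so no
  denominators arise.\<close>

lemma formal_cochains_sn_bracket:
  "u \<in> formal_cochains \<Longrightarrow> v \<in> formal_cochains \<Longrightarrow> sn_bracket u v \<in> formal_cochains"
  unfolding sn_bracket_def
  by (intro formal_cochains_sum formal_cochains_diff formal_cochains_wedge formal_cochains_pd
      formal_cochains_left_deriv formal_cochains_right_deriv)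

lemma formal_cochains_lin_field: "lin_field l i \<in> formal_cochains"
  by (simp add: formal_cochains_def lin_field_def vector_field_nth range_to_fract_closed(1))

section \<open>Commuting linear fields and their action on numerators over \<open>D\<close>\<close>

locale commuting_linear_fields =
  fixes l :: "'n::{finite,linorder} mfps_matrix"
  assumes linear: "\<And>i s. l $ i $ s \<in> homogeneous 1"
    and commuting: "\<And>i j. sn_bracket (lin_field l i) (lin_field l j) = 0"
    and det_nonzero: "det l \<noteq> 0"
begin

definition Yder :: "'n \<Rightarrow> 'n mfps \<Rightarrow> 'n mfps" where
  "Yder i f = (\<Sum>s\<in>UNIV. l $ i $ s * mfps_pd s f)"

definition Ydiv :: "'n \<Rightarrow> 'n mfps" where
  "Ydiv i = (\<Sum>s\<in>UNIV. mfps_pd s (l $ i $ s))"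

text \<open>The action of \<open>Y\<^sub>i\<close> on numerators: \<open>Y\<^sub>i (f / D) = Ytw i f / D\<close>.\<close>

definition Ytw :: "'n \<Rightarrow> 'n mfps \<Rightarrow> 'n mfps" where
  "Ytw i f = Yder i f - Ydiv i * f"

definition overD :: "'n mfps \<Rightarrow> 'n mfps fract" where
  "overD f = inverse (to_fract (det l)) * to_fract f"

lemma Yder_add: "Yder i (f + g) = Yder i f + Yder i g"
  by (simp add: Yder_def mfps_pd_add algebra_simps sum.distrib)

lemma Yder_diff: "Yder i (f - g) = Yder i f - Yder i g"
  by (simp add: Yder_def mfps_pd_diff algebra_simps sum_subtractf)

lemma Yder_mult: "Yder i (f * g) = Yder i f * g + f * Yder i g"
  by (simp add: Yder_def mfps_pd_mult algebra_simps sum.distrib sum_distrib_left)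

text \<open>The difference of the two sides is the \<open>t\<close>-component of the Lie bracket of
  the two fields.\<close>

lemma Yder_commute_entries: "Yder i (l $ j $ t) = Yder j (l $ i $ t)"
proof -
  have "0 = sn_bracket (lin_field l i) (lin_field l j) $ {t}" by (simp add: commuting)
  also have "\<dots> = to_fract (\<Sum>s\<in>UNIV. l $ i $ s * mfps_pd s (l $ j $ t) - l $ j $ s * mfps_pd s (l $ i $ t))"
    unfolding lin_field_def sn_bracket_vector_field vector_field_nth fract_pd_to_fract
    by (simp only: card.empty card_insert_disjoint finite.emptyI empty_iff not_False_eq_True
        One_nat_def simp_thms if_True the_elem_eq to_fract_sum to_fract_diff to_fract_mult)
  finally have "to_fract (Yder i (l $ j $ t) - Yder j (l $ i $ t)) = 0"
    unfolding Yder_def sum_subtractf by (rule sym)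
  then show ?thesis by (simp only: to_fract_eq_0_iff right_minus_eq)
qed

text \<open>By commutation, \<open>Y_i\<close> applied to row \<open>j\<close> of \<open>l\<close>
  equals \<open>Y_j\<close> applied to row \<open>i\<close>, which is row \<open>j\<close> times the
  Jacobian matrix of \<open>Y_i\<close>. So \<open>Y_i\<close> acts on \<open>l\<close> by right
  multiplication with a matrix whose trace is the divergence.\<close>

lemma Yder_det: "Yder i (det l) = Ydiv i * det l"
  unfolding Ydiv_def
  by (rule derivation_det_eq_trace[OF Yder_add Yder_mult])
     (subst Yder_commute_entries, simp only: Yder_def)

lemma Yder_commute: "Yder i (Yder j f) = Yder j (Yder i f)"
proof -
  have eq: "Yder i (Yder j f) = (\<Sum>t\<in>UNIV. Yder i (l $ j $ t) * mfps_pd t f) +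
      (\<Sum>s\<in>UNIV. \<Sum>t\<in>UNIV. l $ i $ s * l $ j $ t * mfps_pd s (mfps_pd t f))" for i j
  proof -
    have "Yder i (Yder j f) = (\<Sum>s\<in>UNIV. \<Sum>t\<in>UNIV. l $ i $ s * mfps_pd s (l $ j $ t) * mfps_pd t f +
        l $ i $ s * l $ j $ t * mfps_pd s (mfps_pd t f))"
      by (simp add: Yder_def mfps_pd_sum mfps_pd_mult sum_distrib_left algebra_simps)
    also have "\<dots> = (\<Sum>s\<in>UNIV. \<Sum>t\<in>UNIV. l $ i $ s * mfps_pd s (l $ j $ t) * mfps_pd t f) +
        (\<Sum>s\<in>UNIV. \<Sum>t\<in>UNIV. l $ i $ s * l $ j $ t * mfps_pd s (mfps_pd t f))"
      by (simp add: sum.distrib)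
    also have "(\<Sum>s\<in>UNIV. \<Sum>t\<in>UNIV. l $ i $ s * mfps_pd s (l $ j $ t) * mfps_pd t f) =
        (\<Sum>t\<in>UNIV. Yder i (l $ j $ t) * mfps_pd t f)"
      by (subst sum.swap) (simp add: Yder_def sum_distrib_right)
    finally show ?thesis .
  qed
  have "(\<Sum>s\<in>UNIV. \<Sum>t\<in>UNIV. l $ i $ s * l $ j $ t * mfps_pd s (mfps_pd t f)) =
      (\<Sum>s\<in>UNIV. \<Sum>t\<in>UNIV. l $ j $ s * l $ i $ t * mfps_pd s (mfps_pd t f))"
    by (subst sum.swap) (simp add: mult.commute mfps_pd_commute)
  then show ?thesis
    unfolding eq by (simp add: Yder_commute_entries[of i])
qed

lemma homogeneous_Ydiv: "Ydiv i \<in> homogeneous 0"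
  unfolding Ydiv_def using homogeneous_mfps_pd(1)[OF linear] by (intro homogeneous_sum) simp

lemma Yder_Ydiv: "Yder i (Ydiv j) = 0"
  using homogeneous_mfps_pd(2)[OF homogeneous_Ydiv] by (simp add: Yder_def)

lemma homogeneous_Yder:
  assumes "f \<in> homogeneous r"
  shows "Yder i f \<in> homogeneous r"
\<comment> \<open>A linear coefficient restores the degree lost by differentiation; truncated
  subtraction breaks this count at \<open>r = 0\<close>, where the derivative vanishes
  instead.\<close>
proof (cases "r = 0")
  case True
  then show ?thesis using homogeneous_mfps_pd(2)[OF assms] by (simp add: Yder_def homogeneous_0)
next
  case False
  then have "l $ i $ s * mfps_pd s f \<in> homogeneous r" for s
    using homogeneous_mult[OF linear homogeneous_mfps_pd(1)[OF assms], of i s s] by simp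
  then show ?thesis unfolding Yder_def by (intro homogeneous_sum)
qed

lemma homogeneous_Ytw: "f \<in> homogeneous r \<Longrightarrow> Ytw i f \<in> homogeneous r"
  unfolding Ytw_def using homogeneous_mult[OF homogeneous_Ydiv, of f r i]
  by (simp add: homogeneous_diff homogeneous_Yder)

text \<open>The divergences are killed by every \<open>Yder\<close>, so the cross terms are
  symmetric in \<open>i\<close> and \<open>j\<close>.\<close>

lemma Ytw_commute: "Ytw i (Ytw j f) = Ytw j (Ytw i f)"
  by (simp add: Ytw_def Yder_diff Yder_mult Yder_Ydiv Yder_commute[of i] algebra_simps)

lemma overD_eq: "overD f = Fract f (det l)"
  using det_nonzero by (simp add: overD_def Fract_conv_to_fract divide_inverse mult.commute)

text \<open>In the quotient rule the derivative of \<open>D\<close> is a multiple of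
  \<open>D\<close>, so one factor cancels and the denominator stays \<open>D\<close> instead of
  growing to its square.\<close>

lemma lie_overD: "(\<Sum>s\<in>UNIV. to_fract (l $ i $ s) * fract_pd s (overD f)) = overD (Ytw i f)"
proof -
  let ?D = "det l"
  have D: "to_fract ?D \<noteq> 0" using det_nonzero by simp
  have "fract_pd s (overD f) = to_fract (mfps_pd s f * ?D - f * mfps_pd s ?D) / (to_fract ?D * to_fract ?D)" for s
    using fract_pd_Fract[OF det_nonzero, of s f] by (simp only: overD_eq Fract_conv_to_fract to_fract_mult)
  then have "(\<Sum>s\<in>UNIV. to_fract (l $ i $ s) * fract_pd s (overD f)) =
      to_fract (\<Sum>s\<in>UNIV. l $ i $ s * (mfps_pd s f * ?D - f * mfps_pd s ?D)) / (to_fract ?D * to_fract ?D)"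
    by (simp add: sum_divide_distrib)
  also have "(\<Sum>s\<in>UNIV. l $ i $ s * (mfps_pd s f * ?D - f * mfps_pd s ?D)) =
      Yder i f * ?D - f * Yder i ?D"
    by (simp add: Yder_def algebra_simps sum_subtractf sum_distrib_left)
  also have "\<dots> = Ytw i f * ?D" by (simp add: Yder_det Ytw_def algebra_simps)
  also have "to_fract (Ytw i f * ?D) / (to_fract ?D * to_fract ?D) = overD (Ytw i f)"
    using D by (simp add: overD_def field_simps)
  finally show ?thesis .
qed

lemma sn_bracket_lin_field_overD:
  "sn_bracket (lin_field l i) (overD f *s w) =
   overD (Ytw i f) *s w + overD f *s sn_bracket (lin_field l i) w"
  using sn_bracket_vector_field_smult[of "\<lambda>s. to_fract (l $ i $ s)"] lie_overD
  by (simp only: lin_field_def)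

text \<open>Such \<open>w\<close> act as constants: in \<open>overD f *s w\<close> the fields
  differentiate the coefficient alone. Wedging with a further field preserves the property, which
  lets the formula for the differential be applied twice.\<close>

definition invariant :: "'n mvf \<Rightarrow> bool" where
  "invariant w \<longleftrightarrow> (\<forall>i. sn_bracket (lin_field l i) w = 0)"

lemma invariant_wedge:
  assumes "invariant w"
  shows "invariant (wedge (lin_field l i) w)"
  unfolding invariant_def
proof
  fix j
  have "sn_bracket (lin_field l j) (wedge (lin_field l i) w) =
      wedge (sn_bracket (lin_field l j) (lin_field l i)) w + wedge (lin_field l i) (sn_bracket (lin_field l j) w)"
    unfolding lin_field_def by (rule sn_bracket_vector_field_wedge)
  then show "sn_bracket (lin_field l j) (wedge (lin_field l i) w) = 0"
    using assms by (simp add: commuting invariant_def wedge_0_left wedge_0_right)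
qed

lemma invariant_lin_field_wedge: "invariant (lin_field_wedge l I)"
proof -
  have "invariant (foldr wedge (map (lin_field l) xs) (axis {} 1))" for xs
  proof (induction xs)
    case Nil
    then show ?case by (simp add: invariant_def lin_field_def sn_bracket_vector_field_unit)
  qed (simp add: invariant_wedge)
  then show ?thesis by (simp add: lin_field_wedge_def)
qed

lemma wedge_lin_field_swap:
  "wedge (lin_field l i) (wedge (lin_field l j) w) = - wedge (lin_field l j) (wedge (lin_field l i) w)"
  unfolding lin_field_def by (rule wedge_vector_field_swap)

lemma wedge_lin_field_wedge:
  "i \<in> I \<Longrightarrow> wedge (lin_field l i) (lin_field_wedge l I) = 0"
  "i \<notin> I \<Longrightarrow> wedge (lin_field l i) (lin_field_wedge l I) = lin_field_wedge l (insert i I) \<or>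
    wedge (lin_field l i) (lin_field_wedge l I) = - lin_field_wedge l (insert i I)"
proof -
  have Y: "lin_field l = (\<lambda>i. vector_field (\<lambda>s. to_fract (l $ i $ s)))"
    by (simp add: fun_eq_iff lin_field_def)
  show "wedge (lin_field l i) (lin_field_wedge l I) = 0" if "i \<in> I"
    unfolding lin_field_wedge_def Y by (rule wedge_fold_wedge_mem) (use that in simp)
  show "wedge (lin_field l i) (lin_field_wedge l I) = lin_field_wedge l (insert i I) \<or>
      wedge (lin_field l i) (lin_field_wedge l I) = - lin_field_wedge l (insert i I)" if "i \<notin> I"
  proof -
    have s: "sorted_list_of_set (insert i I) = insort i (sorted_list_of_set I)"
      using that by (simp add: sorted_list_of_set_insert_remove)
    show ?thesis
      unfolding lin_field_wedge_def Y s by (rule wedge_fold_wedge_insort)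
  qed
qed

definition Lam :: "('n \<Rightarrow> 'n \<Rightarrow> real) \<Rightarrow> 'n mvf" where
  "Lam \<alpha> = (\<Sum>(i, j) \<in> {(i, j). i < j}. \<alpha> i j *\<^sub>R wedge (lin_field l i) (lin_field l j))"

lemma sn_bracket_Lam:
  assumes "invariant w"
  shows "sn_bracket (Lam \<alpha>) (overD f *s w) =
    (\<Sum>(i, j) \<in> {(i, j). i < j}. \<alpha> i j *\<^sub>R
      (overD (Ytw j f) *s wedge (lin_field l i) w - overD (Ytw i f) *s wedge (lin_field l j) w))"
proof -
  have 1: "sn_bracket (lin_field l i) (overD f *s w) = overD (Ytw i f) *s w" for i
    using assms by (simp add: sn_bracket_lin_field_overD invariant_def)
  have 2: "sn_bracket (wedge (lin_field l i) (lin_field l j)) v =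
      wedge (lin_field l i) (sn_bracket (lin_field l j) v) -
      wedge (lin_field l j) (sn_bracket (lin_field l i) v)" for i j v
    unfolding lin_field_def by (rule sn_bracket_bivector)
  show ?thesis
    unfolding Lam_def sn_bracket_sum_left case_prod_unfold sn_bracket_scaleR_left 2 1
      wedge_smult_right ..
qed

lemma sn_bracket_Lam_sum:
  "sn_bracket (Lam \<alpha>) (\<Sum>i\<in>A. f i) = (\<Sum>i\<in>A. sn_bracket (Lam \<alpha>) (f i))"
  by (rule linear_sum[OF linear_sn_bracket])

text \<open>The double sum vanishes because \<open>Y\<^sub>j\<close> and \<open>Y\<^sub>m\<close> commute as operators while they
  anticommute in the exterior algebra.\<close>

lemma sn_bracket_Lam_Lam:
  assumes w: "invariant w"
  shows "sn_bracket (Lam \<alpha>) (sn_bracket (Lam \<alpha>) (overD f *s w)) = 0"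
proof -
  \<comment> \<open>In \<open>G a b c e\<close> the fields \<open>a\<close>, then \<open>b\<close>,
    differentiate the coefficient, while \<open>c\<close>, then \<open>e\<close>, multiply the
    multivector.\<close>
  define G where "G a b c e = overD (Ytw b (Ytw a f)) *s wedge (lin_field l e) (wedge (lin_field l c) w)"
    for a b c e
  \<comment> \<open>\<open>H x y\<close> is the contribution of bracketing with the bivector of
    index pair \<open>x\<close> and then with that of index pair \<open>y\<close>.\<close>
  define H where "H x y = (G (snd x) (snd y) (fst x) (fst y) - G (snd x) (fst y) (fst x) (snd y)) -
      (G (fst x) (snd y) (snd x) (fst y) - G (fst x) (fst y) (snd x) (snd y))" for x y
  let ?S = "{(i, j). i < (j :: 'n)}"
  let ?a = "\<lambda>x. \<alpha> (fst x) (snd x)"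
  have G: "G a b c e = - G b a e c" for a b c e
  proof -
    have "Ytw b (Ytw a f) = Ytw a (Ytw b f)" by (rule Ytw_commute)
    then show ?thesis
      unfolding G_def by (subst wedge_lin_field_swap) (simp only: vec_eq_iff vector_smult_component
        uminus_vec_def vec_lambda_beta mult_minus_right simp_thms)
  qed
  have anti: "H x y = - H y x" for x y
    unfolding H_def
    by (subst G[of "snd x" "snd y"], subst G[of "snd x" "fst y"], subst G[of "fst x" "snd y"],
        subst G[of "fst x" "fst y"]) (simp only: minus_diff_eq diff_conv_add_uminus minus_add_distrib
        minus_minus add.assoc add.commute add.left_commute)
  have H: "sn_bracket (Lam \<alpha>) (overD (Ytw (snd x) f) *s wedge (lin_field l (fst x)) w) -
      sn_bracket (Lam \<alpha>) (overD (Ytw (fst x) f) *s wedge (lin_field l (snd x)) w) =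
      (\<Sum>y\<in>?S. ?a y *\<^sub>R H x y)" for x
    unfolding sn_bracket_Lam[OF invariant_wedge[OF w]] case_prod_unfold sum_subtractf[symmetric]
      scaleR_diff_right[symmetric] H_def G_def ..
  have "sn_bracket (Lam \<alpha>) (sn_bracket (Lam \<alpha>) (overD f *s w)) =
      (\<Sum>x\<in>?S. ?a x *\<^sub>R (\<Sum>y\<in>?S. ?a y *\<^sub>R H x y))"
    unfolding sn_bracket_Lam[OF w] sn_bracket_Lam_sum case_prod_unfold sn_bracket_scaleR_right
      linear_diff[OF linear_sn_bracket] H ..
  also have "\<dots> = (\<Sum>x\<in>?S. \<Sum>y\<in>?S. (?a x * ?a y) *\<^sub>R H x y)"
    by (simp only: scaleR_sum_right scaleR_scaleR)
  finally have eq: "sn_bracket (Lam \<alpha>) (sn_bracket (Lam \<alpha>) (overD f *s w)) =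
      (\<Sum>x\<in>?S. \<Sum>y\<in>?S. (?a x * ?a y) *\<^sub>R H x y)" .
  \<comment> \<open>Exchanging the summations interchanges the roles of \<open>x\<close> and
    \<open>y\<close>; the weight is symmetric and \<open>H\<close> antisymmetric, so the sum equals
    its own negative.\<close>
  also have "\<dots> = (\<Sum>y\<in>?S. \<Sum>x\<in>?S. (?a x * ?a y) *\<^sub>R H x y)"
    by (rule sum.swap)
  also have "\<dots> = (\<Sum>y\<in>?S. \<Sum>x\<in>?S. - ((?a y * ?a x) *\<^sub>R H y x))"
    by (intro sum.cong refl, subst anti) (simp only: scaleR_minus_right mult.commute)
  also have "\<dots> = - sn_bracket (Lam \<alpha>) (sn_bracket (Lam \<alpha>) (overD f *s w))"
    unfolding eq sum_negf ..
  finally show ?thesis by (rule mvf_eq_minus_self)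
qed

section \<open>The homogeneous components as a complex with a subcomplex\<close>

lemma Pcomp_eq:
  "Pcomp l r p = {\<Sum>I | int (card I) = p. overD (f I) *s lin_field_wedge l I | f. \<forall>I. f I \<in> homogeneous r}"
  unfolding Pcomp_def smult_sum_mvf vector_smult_assoc overD_def ..

lemma overD_add: "overD (f + g) = overD f + overD g"
  by (simp add: overD_def algebra_simps)

lemma overD_scaleR: "overD (c *\<^sub>R f) *s w = c *\<^sub>R (overD f *s w :: 'n mvf)"
  by (simp add: overD_def scaleR_mvf vector_smult_assoc scaleR_conv_of_real mult_ac)

lemma overD_0: "overD 0 = 0"
  by (simp add: overD_def)

lemma overD_in_Pcomp:
  assumes "f \<in> homogeneous r" "int (card I) = p"
  shows "overD f *s lin_field_wedge l I \<in> Pcomp l r p"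
proof -
  let ?f = "\<lambda>J. if J = I then f else 0"
  have "(\<Sum>J | int (card J) = p. overD (?f J) *s lin_field_wedge l J) =
      (\<Sum>J | int (card J) = p. if J = I then overD f *s lin_field_wedge l I else 0)"
    by (rule sum.cong) (auto simp: overD_0)
  also have "\<dots> = overD f *s lin_field_wedge l I"
    using assms(2) by simp
  finally show ?thesis
    unfolding Pcomp_eq using assms(1)
    by (intro CollectI exI[of _ ?f]) (simp add: homogeneous_0)
qed

lemma subspace_Pcomp: "subspace (Pcomp l r p)"
proof (rule subspaceI)
  show "0 \<in> Pcomp l r p"
    unfolding Pcomp_eq
    by (intro CollectI exI[of _ "\<lambda>_. 0"]) (simp add: homogeneous_0 overD_0)
next
  fix x y assume "x \<in> Pcomp l r p" "y \<in> Pcomp l r p"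
  then obtain f g where
    f: "x = (\<Sum>I | int (card I) = p. overD (f I) *s lin_field_wedge l I)" "\<And>I. f I \<in> homogeneous r" and
    g: "y = (\<Sum>I | int (card I) = p. overD (g I) *s lin_field_wedge l I)" "\<And>I. g I \<in> homogeneous r"
    unfolding Pcomp_eq by blast
  have "x + y = (\<Sum>I | int (card I) = p. overD (f I + g I) *s lin_field_wedge l I)"
    unfolding f(1) g(1) sum.distrib[symmetric] overD_add vector_sadd_rdistrib ..
  then show "x + y \<in> Pcomp l r p"
    unfolding Pcomp_eq using homogeneous_add[OF f(2) g(2)]
    by (intro CollectI exI[of _ "\<lambda>I. f I + g I"]) simp
next
  fix c x assume "x \<in> Pcomp l r p"
  then obtain f where
    f: "x = (\<Sum>I | int (card I) = p. overD (f I) *s lin_field_wedge l I)" "\<And>I. f I \<in> homogeneous r"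
    unfolding Pcomp_eq by blast
  have "c *\<^sub>R x = (\<Sum>I | int (card I) = p. overD (c *\<^sub>R f I) *s lin_field_wedge l I)"
    unfolding f(1) scaleR_sum_right overD_scaleR ..
  then show "c *\<^sub>R x \<in> Pcomp l r p"
    unfolding Pcomp_eq using homogeneous_scaleR[OF f(2)]
    by (intro CollectI exI[of _ "\<lambda>I. c *\<^sub>R f I"]) simp
qed

lemma overD_wedge_in_Pcomp:
  assumes f: "f \<in> homogeneous r" and I: "int (card I) = p"
  shows "overD f *s wedge (lin_field l i) (lin_field_wedge l I) \<in> Pcomp l r (p + 1)"
proof (cases "i \<in> I")
  case True
  then show ?thesis using subspace_0[OF subspace_Pcomp] by (simp add: wedge_lin_field_wedge(1))
next
  case False
  then have "overD f *s lin_field_wedge l (insert i I) \<in> Pcomp l r (p + 1)"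
    using I by (intro overD_in_Pcomp[OF f]) simp
  moreover from this have "- (overD f *s lin_field_wedge l (insert i I)) \<in> Pcomp l r (p + 1)"
    by (rule subspace_neg[OF subspace_Pcomp])
  ultimately show ?thesis
    using wedge_lin_field_wedge(2)[OF False] by (auto simp: vector_smult_rneg)
qed

lemma sn_bracket_Lam_Pcomp:
  assumes "x \<in> Pcomp l r p"
  shows "sn_bracket (Lam \<alpha>) x \<in> Pcomp l r (p + 1)" and "sn_bracket (Lam \<alpha>) (sn_bracket (Lam \<alpha>) x) = 0"
proof -
  obtain f where
    f: "x = (\<Sum>I | int (card I) = p. overD (f I) *s lin_field_wedge l I)" "\<And>I. f I \<in> homogeneous r"
    using assms unfolding Pcomp_eq by blast
  show "sn_bracket (Lam \<alpha>) x \<in> Pcomp l r (p + 1)"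
    unfolding f(1) sn_bracket_Lam_sum sn_bracket_Lam[OF invariant_lin_field_wedge] case_prod_unfold
    by (intro subspace_sum subspace_scale subspace_diff subspace_Pcomp overD_wedge_in_Pcomp
        homogeneous_Ytw f(2)) simp_all
  show "sn_bracket (Lam \<alpha>) (sn_bracket (Lam \<alpha>) x) = 0"
    unfolding f(1) sn_bracket_Lam_sum sn_bracket_Lam_Lam[OF invariant_lin_field_wedge] by simp
qed

lemma formal_cochains_Lam: "Lam \<alpha> \<in> formal_cochains"
  unfolding Lam_def case_prod_unfold
  by (intro formal_cochains_sum formal_cochains_scaleR formal_cochains_wedge formal_cochains_lin_field)

lemma sn_bracket_Lam_Rcomp: "x \<in> Rcomp l r p \<Longrightarrow> sn_bracket (Lam \<alpha>) x \<in> Rcomp l r (p + 1)"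
  by (simp add: Rcomp_def sn_bracket_Lam_Pcomp(1) formal_cochains_sn_bracket formal_cochains_Lam)

lemma subspace_Rcomp: "subspace (Rcomp l r p)"
  unfolding Rcomp_def
  by (intro subspace_inter subspace_Pcomp subspaceI formal_cochains_0 formal_cochains_add
      formal_cochains_scaleR)

end

theorem theorem6:
  fixes l :: "'n::{finite,linorder} mfps_matrix"
    and \<alpha> :: "'n \<Rightarrow> 'n \<Rightarrow> real"
    and \<Lambda> :: "'n mvf"
    and p r :: nat
  assumes linear: "\<And>i s. l $ i $ s \<in> homogeneous 1"
    and commuting: "\<And>i j. sn_bracket (lin_field l i) (lin_field l j) = 0"
    and det_nonzero: "det l \<noteq> 0"
    and Lambda: "\<Lambda> = (\<Sum>(i, j) \<in> {(i, j). i < j}. \<alpha> i j *\<^sub>R wedge (lin_field l i) (lin_field l j))"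
    and degree: "p \<le> CARD('n)"
  shows "sections l \<Lambda> r (int p) \<noteq> {} \<and>
    (\<forall>\<sigma> \<in> sections l \<Lambda> r (int p).
       LH_R l \<Lambda> r (int p) \<cong>\<^sub>\<real>
       dsum_module
         (quot_module (LH_P l \<Lambda> r (int p)) (\<sigma> ` ker_connecting l \<Lambda> r (int p)))
         (quot_module (LH_PR l \<Lambda> r (int p - 1)) (ker_connecting l \<Lambda> r (int p - 1))))"
proof -
  interpret Y: commuting_linear_fields l
    by unfold_locales (fact linear commuting det_nonzero)+
  have \<Lambda>: "\<Lambda> = Y.Lam \<alpha>"
    unfolding Lambda Y.Lam_def ..
  interpret C: cochain_pair "Pcomp l r" "Rcomp l r" "sn_bracket \<Lambda>"
    unfolding \<Lambda>
  proof (rule cochain_pair.intro)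
    show "Rcomp l r q \<subseteq> Pcomp l r q" for q by (simp add: Rcomp_def)
  qed (simp_all only: Y.subspace_Pcomp Y.subspace_Rcomp linear_sn_bracket
      Y.sn_bracket_Lam_Pcomp Y.sn_bracket_Lam_Rcomp)
  have CP: "C.CP = Pcplx l r" and CR: "C.CR = Rcplx l r"
    by (simp_all add: fun_eq_iff C.CP_def C.CR_def Pcplx_def Rcplx_def)
  have CQ: "C.CQ = PRcplx l r"
    by (simp add: fun_eq_iff C.CQ_def PRcplx_def CP)
  have dQ: "C.dQ = PRdiff l \<Lambda> r"
    by (simp add: fun_eq_iff C.dQ_def PRdiff_def CP)
  have HP: "C.HP = LH_P l \<Lambda> r" and HR: "C.HR = LH_R l \<Lambda> r" and HQ: "C.HQ = LH_PR l \<Lambda> r"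
    by (simp_all only: C.HP_def C.HR_def C.HQ_def LH_P_def LH_R_def LH_PR_def CP CR CQ dQ)
  have nat: "C.nat_map = natural_map l \<Lambda> r" and conn: "C.conn = connecting l \<Lambda> r"
    by (simp_all add: fun_eq_iff C.nat_map_def natural_map_def C.conn_def connecting_def CP CR CQ dQ)
  have ker: "C.ker_conn = ker_connecting l \<Lambda> r"
    by (simp add: fun_eq_iff C.ker_conn_def ker_connecting_def HQ HR conn)
  have secs: "C.secs = sections l \<Lambda> r"
    by (simp add: fun_eq_iff C.secs_def sections_def HQ HP ker nat)
  \<comment> \<open>For \<open>p = 0\<close> the second summand sits in degree -1, where no index
    set has the required cardinality and all cochains vanish; the integer grading absorbs this
    case.\<close>
  show ?thesis
    using C.secs_nonempty[of "int p"] C.HR_decomposition[of _ "int p"]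
    unfolding secs HR HP HQ ker by blast
qed

end
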